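(* Let $R$ be an arithmetic ring which is self fp-injective. Then $\lambda\text{-}\dim(R)\le 2$.
   Context: All rings are commutative with identity. $R$ is arithmetic if $R_M$ is a valuation ring (ideals totally ordered by inclusion) for every maximal ideal $M$. An $R$-module $E$ is fp-injective if $\mathrm{Ext}^1_R(F,E)=0$ for every finitely presented $R$-module $F$; $R$ is self fp-injective if $R$ is fp-injective as an $R$-module. For an $R$-module $E$, $\lambda_R(E)$ is the supremum of the $n$ for which there is an exact sequence $F_n\to\cdots\to F_0\to E\to0$ with $F_i$ free of finite rank ($-1$ if $E$ is not finitely generated); $\lambda\text{-}\dim(R)$ is the least $n$ (or $\infty$) such that $\lambda_R(E)\ge n$ implies $\lambda_R(E)=\infty$ for all $E$. *)

theory Defs
  imports "HOL-Algebra.Algebra" "HOL-Library.Extended_Real"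
begin

definition loc_rel :: "'a ring \<Rightarrow> 'a set \<Rightarrow> (('a \<times> 'a) \<times> ('a \<times> 'a)) set" where
  "loc_rel R S = {((r, s), (r', s')). r \<in> carrier R \<and> s \<in> S \<and> r' \<in> carrier R \<and> s' \<in> S \<and>
      (\<exists>t\<in>S. t \<otimes>\<^bsub>R\<^esub> ((r \<otimes>\<^bsub>R\<^esub> s') \<ominus>\<^bsub>R\<^esub> (r' \<otimes>\<^bsub>R\<^esub> s)) = \<zero>\<^bsub>R\<^esub>)}"

definition localization :: "'a ring \<Rightarrow> 'a set \<Rightarrow> ('a \<times> 'a) set ring" where
  "localization R S =
     \<lparr> carrier = (carrier R \<times> S) // loc_rel R S,
       monoid.mult = (\<lambda>A B. {z. \<exists>r s r' s'. (r, s) \<in> A \<and> (r', s') \<in> B \<and>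
                          (z, (r \<otimes>\<^bsub>R\<^esub> r', s \<otimes>\<^bsub>R\<^esub> s')) \<in> loc_rel R S}),
       one = loc_rel R S `` {(\<one>\<^bsub>R\<^esub>, \<one>\<^bsub>R\<^esub>)},
       ring.zero = loc_rel R S `` {(\<zero>\<^bsub>R\<^esub>, \<one>\<^bsub>R\<^esub>)},
       ring.add = (\<lambda>A B. {z. \<exists>r s r' s'. (r, s) \<in> A \<and> (r', s') \<in> B \<and>
                          (z, ((r \<otimes>\<^bsub>R\<^esub> s') \<oplus>\<^bsub>R\<^esub> (r' \<otimes>\<^bsub>R\<^esub> s), s \<otimes>\<^bsub>R\<^esub> s')) \<in> loc_rel R S}) \<rparr>"

definition localization_at :: "'a ring \<Rightarrow> 'a set \<Rightarrow> ('a \<times> 'a) set ring" where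
  "localization_at R P = localization R (carrier R - P)"

definition valuation_ring :: "('b, 'c) ring_scheme \<Rightarrow> bool" where
  "valuation_ring A \<longleftrightarrow> (\<forall>I J. ideal I A \<and> ideal J A \<longrightarrow> I \<subseteq> J \<or> J \<subseteq> I)"

definition arithmetic_ring :: "'a ring \<Rightarrow> bool" where
  "arithmetic_ring R \<longleftrightarrow> cring R \<and>
     (\<forall>M. maximalideal M R \<longrightarrow> valuation_ring (localization_at R M))"

definition linear_map :: "'a ring \<Rightarrow> ('a, 'm) module \<Rightarrow> ('a, 'n) module \<Rightarrow> ('m \<Rightarrow> 'n) \<Rightarrow> bool" where
  "linear_map R M N f \<longleftrightarrow> f \<in> carrier M \<rightarrow> carrier N \<and>
     (\<forall>x\<in>carrier M. \<forall>y\<in>carrier M. f (x \<oplus>\<^bsub>M\<^esub> y) = f x \<oplus>\<^bsub>N\<^esub> f y) \<and>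
     (\<forall>a\<in>carrier R. \<forall>x\<in>carrier M. f (a \<odot>\<^bsub>M\<^esub> x) = a \<odot>\<^bsub>N\<^esub> f x)"

definition lin_kernel :: "('a, 'm) module \<Rightarrow> ('a, 'n) module \<Rightarrow> ('m \<Rightarrow> 'n) \<Rightarrow> 'm set" where
  "lin_kernel M N f = {x \<in> carrier M. f x = \<zero>\<^bsub>N\<^esub>}"

definition free_module :: "'a ring \<Rightarrow> nat \<Rightarrow> ('a, nat \<Rightarrow> 'a) module" where
  "free_module R k =
     \<lparr> carrier = {v. (\<forall>i<k. v i \<in> carrier R) \<and> (\<forall>i\<ge>k. v i = \<zero>\<^bsub>R\<^esub>)},
       monoid.mult = (\<lambda>v w i. \<zero>\<^bsub>R\<^esub>),
       one = (\<lambda>i. \<zero>\<^bsub>R\<^esub>),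
       ring.zero = (\<lambda>i. \<zero>\<^bsub>R\<^esub>),
       ring.add = (\<lambda>v w i. v i \<oplus>\<^bsub>R\<^esub> w i),
       module.smult = (\<lambda>a v i. a \<otimes>\<^bsub>R\<^esub> v i) \<rparr>"

definition self_module :: "'a ring \<Rightarrow> ('a, 'a) module" where
  "self_module R =
     \<lparr> carrier = carrier R, monoid.mult = (\<lambda>x y. x \<otimes>\<^bsub>R\<^esub> y), one = \<one>\<^bsub>R\<^esub>,
       ring.zero = \<zero>\<^bsub>R\<^esub>, ring.add = (\<lambda>x y. x \<oplus>\<^bsub>R\<^esub> y),
       module.smult = (\<lambda>x y. x \<otimes>\<^bsub>R\<^esub> y) \<rparr>"

definition has_partial_resolution :: "'a ring \<Rightarrow> ('a, 'm) module \<Rightarrow> nat \<Rightarrow> bool" where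
  "has_partial_resolution R E n \<longleftrightarrow>
     (\<exists>(k :: nat \<Rightarrow> nat) (d0 :: (nat \<Rightarrow> 'a) \<Rightarrow> 'm) (d :: nat \<Rightarrow> (nat \<Rightarrow> 'a) \<Rightarrow> (nat \<Rightarrow> 'a)).
        linear_map R (free_module R (k 0)) E d0 \<and>
        d0 ` carrier (free_module R (k 0)) = carrier E \<and>
        (\<forall>i\<in>{1..n}. linear_map R (free_module R (k i)) (free_module R (k (i - 1))) (d i)) \<and>
        (1 \<le> n \<longrightarrow> d 1 ` carrier (free_module R (k 1)) = lin_kernel (free_module R (k 0)) E d0) \<and>
        (\<forall>i\<in>{1..<n}. d (i + 1) ` carrier (free_module R (k (i + 1))) =
                       lin_kernel (free_module R (k i)) (free_module R (k (i - 1))) (d i)))"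

text \<open>lambda_R(E): supremum of the n admitting such a sequence; -1 if there is none
  (i.e. E is not finitely generated).\<close>
definition lambda_inv :: "'a ring \<Rightarrow> ('a, 'm) module \<Rightarrow> ereal" where
  "lambda_inv R E = Sup ({-1} \<union> {ereal (real n) | n. has_partial_resolution R E n})"

definition finitely_presented :: "'a ring \<Rightarrow> ('a, 'm) module \<Rightarrow> bool" where
  "finitely_presented R F \<longleftrightarrow> has_partial_resolution R F 1"

text \<open>Ext^1_R(F,E) = 0, in Yoneda form: every short exact sequence 0 -> E -> X -> F -> 0
  splits. Every such extension X is isomorphic to one whose underlying set is a subset
  of carrier E \<times> carrier F, so X may be taken on the type 'e \<times> 'f.\<close>
definition Ext1_vanishes :: "'a ring \<Rightarrow> ('a, 'f) module \<Rightarrow> ('a, 'e) module \<Rightarrow> bool" where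
  "Ext1_vanishes R F E \<longleftrightarrow>
     (\<forall>(Xm :: ('a, 'e \<times> 'f) module) (i :: 'e \<Rightarrow> 'e \<times> 'f) (p :: 'e \<times> 'f \<Rightarrow> 'f).
        module R Xm \<and> linear_map R E Xm i \<and> inj_on i (carrier E) \<and>
        linear_map R Xm F p \<and> p ` carrier Xm = carrier F \<and>
        i ` carrier E = lin_kernel Xm F p
        \<longrightarrow> (\<exists>s. linear_map R F Xm s \<and> (\<forall>y\<in>carrier F. p (s y) = y)))"

text \<open>fp-injective: Ext^1(F,E) = 0 for every finitely presented F. A finitely presented
  module is a quotient of some R^n, whose carrier is a subset of the type nat => 'a;
  hence every finitely presented module is isomorphic to one on that type.\<close>
definition fp_injective :: "'a ring \<Rightarrow> ('a, 'e) module \<Rightarrow> bool" where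
  "fp_injective R E \<longleftrightarrow>
     (\<forall>F :: ('a, nat \<Rightarrow> 'a) module. module R F \<and> finitely_presented R F \<longrightarrow> Ext1_vanishes R F E)"

definition self_fp_injective :: "'a ring \<Rightarrow> bool" where
  "self_fp_injective R \<longleftrightarrow> fp_injective R (self_module R)"

end

theory Submission
  imports Defs
begin

text \<open>Let \<open>F\<^sub>n \<rightarrow> F\<^sub>n\<^sub>-\<^sub>1 \<rightarrow> F\<^sub>n\<^sub>-\<^sub>2\<close> be exact with \<open>n \<ge> 2\<close>, given by matrices \<open>B\<close> and \<open>A\<close>. Self
  fp-injectivity says that every functional on \<open>F\<^sub>n\<^sub>-\<^sub>1\<close> vanishing on \<open>ker A\<close> factors through \<open>A\<close>, so
  the kernel of the transpose of \<open>B\<close> is the row space of \<open>A\<close>, which is finitely generated. Over an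
  arithmetic ring the kernel of a matrix is finitely generated iff that of its transpose is: near each
  maximal ideal one entry divides all the others, and Gaussian elimination reduces the matrix to a
  diagonal one, for which both kernels are built from the annihilators of the diagonal entries. Hence
  \<open>ker B\<close> is finitely generated and the resolution extends by one step. Localizations are avoided by
  carrying a denominator outside the maximal ideal.\<close>

section \<open>Localization and comparability of elements\<close>

text \<open>The bound is 2 because the argument needs two consecutive matrices: the rows of
  \<open>A\<close> generate the kernel of the transpose of \<open>B\<close>, and for
  \<open>n = 1\<close> the map following \<open>B\<close> is \<open>d0\<close>, which takes values
  in an arbitrary module and has no rows. Finite generation of all localizations would not suffice:
  every ideal of a von Neumann regular ring is locally principal, yet such a ring may have ideals
  that are not finitely generated. The local condition used is stronger: a single \<open>s\<close>
  outside \<open>M\<close> with \<open>s K\<close> inside the span of a finite subset of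
  \<open>K\<close>. Such \<open>s\<close> form an ideal, and an ideal contained in no maximal ideal
  contains \<open>\<one>\<close>. The annihilators of the pivots are not known to be finitely
  generated, so only the equivalence of the two kernels is proved locally. It survives elimination
  because a pivot has the same annihilator in a matrix and its transpose, and the Schur complement
  of the transpose is the transpose of the Schur complement.\<close>

locale mult_set = cring R for R :: "'a ring" (structure) +
  fixes S
  assumes S_sub: "S \<subseteq> carrier R" and one_S: "\<one> \<in> S"
    and mult_S: "\<lbrakk>s \<in> S; t \<in> S\<rbrakk> \<Longrightarrow> s \<otimes> t \<in> S"
begin

lemma S_closed [simp]: "s \<in> S \<Longrightarrow> s \<in> carrier R"
  using S_sub by blast

definition frac :: "'a \<Rightarrow> 'a \<Rightarrow> ('a \<times> 'a) set" where
  "frac r s = loc_rel R S `` {(r, s)}"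

lemma loc_rel_iff:
  assumes "r \<in> carrier R" "s \<in> S" "r' \<in> carrier R" "s' \<in> S"
  shows "((r, s), (r', s')) \<in> loc_rel R S \<longleftrightarrow> (\<exists>t\<in>S. t \<otimes> (r \<otimes> s') = t \<otimes> (r' \<otimes> s))"
proof -
  have "t \<otimes> (r \<otimes> s' \<ominus> r' \<otimes> s) = \<zero> \<longleftrightarrow> t \<otimes> (r \<otimes> s') = t \<otimes> (r' \<otimes> s)" if "t \<in> S" for t
  proof -
    have "t \<otimes> (r \<otimes> s' \<ominus> r' \<otimes> s) = t \<otimes> (r \<otimes> s') \<ominus> t \<otimes> (r' \<otimes> s)"
      using assms that S_closed by algebra
    then show ?thesis
      using assms that by simp
  qed
  then show ?thesis
    using assms by (auto simp: loc_rel_def)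
qed

lemma equiv_loc_rel: "equiv (carrier R \<times> S) (loc_rel R S)"
proof (rule equivI)
  show "loc_rel R S \<subseteq> (carrier R \<times> S) \<times> (carrier R \<times> S)"
    by (auto simp: loc_rel_def)
  show "refl_on (carrier R \<times> S) (loc_rel R S)"
    using one_S by (auto simp: refl_on_def loc_rel_iff)
  show "sym (loc_rel R S)"
  proof (rule symI, clarify)
    fix r s r' s' assume a: "((r, s), (r', s')) \<in> loc_rel R S"
    then have "r \<in> carrier R" "s \<in> S" "r' \<in> carrier R" "s' \<in> S"
      by (auto simp: loc_rel_def)
    with a show "((r', s'), (r, s)) \<in> loc_rel R S"
      unfolding loc_rel_iff[OF \<open>r \<in> carrier R\<close> \<open>s \<in> S\<close> \<open>r' \<in> carrier R\<close> \<open>s' \<in> S\<close>]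
        loc_rel_iff[OF \<open>r' \<in> carrier R\<close> \<open>s' \<in> S\<close> \<open>r \<in> carrier R\<close> \<open>s \<in> S\<close>] by metis
  qed
  show "trans (loc_rel R S)"
  proof (rule transI, clarify)
    fix a s b t c u
    assume ab: "((a, s), (b, t)) \<in> loc_rel R S" and bc: "((b, t), (c, u)) \<in> loc_rel R S"
    then have car: "a \<in> carrier R" "s \<in> S" "b \<in> carrier R" "t \<in> S" "c \<in> carrier R" "u \<in> S"
      by (auto simp: loc_rel_def)
    from ab car obtain v where v: "v \<in> S" "v \<otimes> (a \<otimes> t) = v \<otimes> (b \<otimes> s)"
      by (auto simp: loc_rel_iff)
    from bc car obtain w where w: "w \<in> S" "w \<otimes> (b \<otimes> u) = w \<otimes> (c \<otimes> t)"
      by (auto simp: loc_rel_iff)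
    \<comment> \<open>The multiplier contains the middle denominator \<open>t\<close>, because
      \<open>t\<close> cannot be cancelled in a ring with zero divisors.\<close>
    have "(v \<otimes> w \<otimes> t) \<otimes> (a \<otimes> u) = w \<otimes> u \<otimes> (v \<otimes> (a \<otimes> t))"
      using car S_closed[OF v(1)] S_closed[OF w(1)] car(2,4,6)[THEN S_closed] by algebra
    also have "\<dots> = v \<otimes> s \<otimes> (w \<otimes> (b \<otimes> u))"
      unfolding v(2) using car S_closed[OF v(1)] S_closed[OF w(1)] car(2,4,6)[THEN S_closed] by algebra
    also have "\<dots> = (v \<otimes> w \<otimes> t) \<otimes> (c \<otimes> s)"
      unfolding w(2) using car S_closed[OF v(1)] S_closed[OF w(1)] car(2,4,6)[THEN S_closed] by algebra
    finally show "((a, s), (c, u)) \<in> loc_rel R S"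
      using car v w by (auto simp: loc_rel_iff intro!: bexI[of _ "v \<otimes> w \<otimes> t"] mult_S)
  qed
qed

lemma frac_eq_iff:
  assumes "r \<in> carrier R" "s \<in> S" "r' \<in> carrier R" "s' \<in> S"
  shows "frac r s = frac r' s' \<longleftrightarrow> (\<exists>t\<in>S. t \<otimes> (r \<otimes> s') = t \<otimes> (r' \<otimes> s))"
  using eq_equiv_class_iff[OF equiv_loc_rel, of "(r, s)" "(r', s')"] assms
  by (simp add: frac_def loc_rel_iff)

lemma frac_self_mem:
  assumes "r \<in> carrier R" "s \<in> S"
  shows "(r, s) \<in> frac r s"
  using assms equiv_class_self[OF equiv_loc_rel] by (simp add: frac_def)

lemma frac_memD:
  assumes "(a, b) \<in> frac r s"
  shows "r \<in> carrier R" "s \<in> S" "a \<in> carrier R" "b \<in> S" "frac a b = frac r s"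
proof -
  have "((r, s), (a, b)) \<in> loc_rel R S" using assms by (simp add: frac_def)
  then show "r \<in> carrier R" "s \<in> S" "a \<in> carrier R" "b \<in> S" "frac a b = frac r s"
    using equiv_class_eq[OF equiv_loc_rel, of "(r, s)" "(a, b)"] unfolding frac_def
    by (auto simp: loc_rel_def)
qed

text \<open>The operations of \<open>localization\<close> collect the \<open>z\<close> related to a
  product or sum from the left; symmetry turns such a set into an equivalence class.\<close>

lemma loc_rel_class: "{z. (z, w) \<in> loc_rel R S} = loc_rel R S `` {w}"
  using equiv_loc_rel by (auto simp: equiv_def sym_def)

lemma carrier_localization:
  "carrier (localization R S) = {frac r s | r s. r \<in> carrier R \<and> s \<in> S}"
  unfolding localization_def quotient_def frac_def by auto

text \<open>\<open>localization\<close> takes all representatives at once. Each pair yields the same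
  class, the product of the two witnessing multipliers being a new witness, so the union is that one
  class.\<close>

lemma localization_mult:
  assumes "r \<in> carrier R" "s \<in> S" "r' \<in> carrier R" "s' \<in> S"
  shows "frac r s \<otimes>\<^bsub>localization R S\<^esub> frac r' s' = frac (r \<otimes> r') (s \<otimes> s')"
proof -
  have "frac (a \<otimes> a') (b \<otimes> b') = frac (r \<otimes> r') (s \<otimes> s')"
    if "(a, b) \<in> frac r s" "(a', b') \<in> frac r' s'" for a b a' b'
  proof -
    note c = frac_memD[OF that(1)] frac_memD[OF that(2)]
    obtain t where t: "t \<in> S" "t \<otimes> (a \<otimes> s) = t \<otimes> (r \<otimes> b)"
      using c frac_eq_iff by metis
    obtain t' where t': "t' \<in> S" "t' \<otimes> (a' \<otimes> s') = t' \<otimes> (r' \<otimes> b')"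
      using c frac_eq_iff by metis
    note cc = c c(2,4,7,9)[THEN S_closed] t(1)[THEN S_closed] t'(1)[THEN S_closed]
    have "(t \<otimes> t') \<otimes> (a \<otimes> a' \<otimes> (s \<otimes> s')) = (t \<otimes> (a \<otimes> s)) \<otimes> (t' \<otimes> (a' \<otimes> s'))"
      using cc by algebra
    also have "\<dots> = (t \<otimes> t') \<otimes> (r \<otimes> r' \<otimes> (b \<otimes> b'))"
      unfolding t(2) t'(2) using cc by algebra
    finally show ?thesis
      using cc t t' by (subst frac_eq_iff) (auto intro!: mult_S bexI[of _ "t \<otimes> t'"])
  qed
  then have "(z, (a \<otimes> a', b \<otimes> b')) \<in> loc_rel R S \<longleftrightarrow> z \<in> frac (r \<otimes> r') (s \<otimes> s')"
    if "(a, b) \<in> frac r s" "(a', b') \<in> frac r' s'" for z a b a' b'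
    using that loc_rel_class unfolding frac_def by blast
  then show ?thesis
    using frac_self_mem[OF assms(1,2)] frac_self_mem[OF assms(3,4)]
    unfolding localization_def by simp blast
qed

lemma localization_add:
  assumes "r \<in> carrier R" "s \<in> S" "r' \<in> carrier R" "s' \<in> S"
  shows "frac r s \<oplus>\<^bsub>localization R S\<^esub> frac r' s' = frac (r \<otimes> s' \<oplus> r' \<otimes> s) (s \<otimes> s')"
proof -
  have "frac (a \<otimes> b' \<oplus> a' \<otimes> b) (b \<otimes> b') = frac (r \<otimes> s' \<oplus> r' \<otimes> s) (s \<otimes> s')"
    if "(a, b) \<in> frac r s" "(a', b') \<in> frac r' s'" for a b a' b'
  proof -
    note c = frac_memD[OF that(1)] frac_memD[OF that(2)]
    obtain t where t: "t \<in> S" "t \<otimes> (a \<otimes> s) = t \<otimes> (r \<otimes> b)"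
      using c frac_eq_iff by metis
    obtain t' where t': "t' \<in> S" "t' \<otimes> (a' \<otimes> s') = t' \<otimes> (r' \<otimes> b')"
      using c frac_eq_iff by metis
    note cc = c c(2,4,7,9)[THEN S_closed] t(1)[THEN S_closed] t'(1)[THEN S_closed]
    have "(t \<otimes> t') \<otimes> ((a \<otimes> b' \<oplus> a' \<otimes> b) \<otimes> (s \<otimes> s'))
        = t' \<otimes> b' \<otimes> s' \<otimes> (t \<otimes> (a \<otimes> s)) \<oplus> t \<otimes> b \<otimes> s \<otimes> (t' \<otimes> (a' \<otimes> s'))"
      using cc by algebra
    also have "\<dots> = (t \<otimes> t') \<otimes> ((r \<otimes> s' \<oplus> r' \<otimes> s) \<otimes> (b \<otimes> b'))"
      unfolding t(2) t'(2) using cc by algebra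
    finally show ?thesis
      using cc t t' by (subst frac_eq_iff) (auto intro!: mult_S bexI[of _ "t \<otimes> t'"])
  qed
  then have "(z, (a \<otimes> b' \<oplus> a' \<otimes> b, b \<otimes> b')) \<in> loc_rel R S \<longleftrightarrow>
      z \<in> frac (r \<otimes> s' \<oplus> r' \<otimes> s) (s \<otimes> s')"
    if "(a, b) \<in> frac r s" "(a', b') \<in> frac r' s'" for z a b a' b'
    using that loc_rel_class unfolding frac_def by blast
  then show ?thesis
    using frac_self_mem[OF assms(1,2)] frac_self_mem[OF assms(3,4)]
    unfolding localization_def by simp blast
qed

lemma localization_one: "\<one>\<^bsub>localization R S\<^esub> = frac \<one> \<one>"
  by (simp add: localization_def frac_def)

lemma localization_zero: "\<zero>\<^bsub>localization R S\<^esub> = frac \<zero> \<one>"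
  by (simp add: localization_def frac_def)

lemma frac_closed: "\<lbrakk>r \<in> carrier R; s \<in> S\<rbrakk> \<Longrightarrow> frac r s \<in> carrier (localization R S)"
  by (auto simp: carrier_localization)

lemma localization_cases:
  assumes "x \<in> carrier (localization R S)"
  obtains r s where "r \<in> carrier R" "s \<in> S" "x = frac r s"
  using assms by (auto simp: carrier_localization)

lemma frac_cong_scale:
  assumes "r \<in> carrier R" "s \<in> S" "t \<in> S"
  shows "frac (r \<otimes> t) (s \<otimes> t) = frac r s"
proof -
  have "\<one> \<otimes> (r \<otimes> t \<otimes> s) = \<one> \<otimes> (r \<otimes> (s \<otimes> t))"
    using assms assms(2,3)[THEN S_closed] by algebra
  then show ?thesis
    using assms one_S by (subst frac_eq_iff) (auto intro: mult_S)
qed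

lemma cring_localization: "cring (localization R S)"
proof (intro cringI abelian_groupI comm_monoidI)
  let ?L = "localization R S"
  note simps = localization_mult localization_add localization_one localization_zero
    frac_closed one_S mult_S
  fix x y z
  assume x: "x \<in> carrier ?L" and y: "y \<in> carrier ?L"
  obtain a s where a: "a \<in> carrier R" "s \<in> S" "x = frac a s" using localization_cases[OF x] .
  obtain b t where b: "b \<in> carrier R" "t \<in> S" "y = frac b t" using localization_cases[OF y] .
  note st = S_closed[OF a(2)] S_closed[OF b(2)]
  show "x \<oplus>\<^bsub>?L\<^esub> y \<in> carrier ?L" "x \<otimes>\<^bsub>?L\<^esub> y \<in> carrier ?L"
    using a b by (simp_all add: simps)
  show "x \<oplus>\<^bsub>?L\<^esub> y = y \<oplus>\<^bsub>?L\<^esub> x" "x \<otimes>\<^bsub>?L\<^esub> y = y \<otimes>\<^bsub>?L\<^esub> x"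
    using a b by (simp_all add: simps m_comm a_comm)
  show "\<zero>\<^bsub>?L\<^esub> \<oplus>\<^bsub>?L\<^esub> x = x" "\<one>\<^bsub>?L\<^esub> \<otimes>\<^bsub>?L\<^esub> x = x"
    using a by (simp_all add: simps)
  have "\<ominus> a \<otimes> s \<oplus> a \<otimes> s = \<zero>" using a(1) st by algebra
  moreover have "frac \<zero> (s \<otimes> s) = frac \<zero> \<one>"
    using a one_S by (subst frac_eq_iff) (auto intro: mult_S)
  ultimately show "\<exists>y\<in>carrier ?L. y \<oplus>\<^bsub>?L\<^esub> x = \<zero>\<^bsub>?L\<^esub>"
    using a by (intro bexI[of _ "frac (\<ominus> a) s"]) (simp_all add: simps)
  assume z: "z \<in> carrier ?L"
  obtain c u where c: "c \<in> carrier R" "u \<in> S" "z = frac c u" using localization_cases[OF z] .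
  note stu = st S_closed[OF c(2)]
  show "x \<otimes>\<^bsub>?L\<^esub> y \<otimes>\<^bsub>?L\<^esub> z = x \<otimes>\<^bsub>?L\<^esub> (y \<otimes>\<^bsub>?L\<^esub> z)"
    using a b c by (simp add: simps m_assoc)
  have "(a \<otimes> t \<oplus> b \<otimes> s) \<otimes> u \<oplus> c \<otimes> (s \<otimes> t) = a \<otimes> (t \<otimes> u) \<oplus> (b \<otimes> u \<oplus> c \<otimes> t) \<otimes> s"
    using a(1) b(1) c(1) stu by algebra
  then show "x \<oplus>\<^bsub>?L\<^esub> y \<oplus>\<^bsub>?L\<^esub> z = x \<oplus>\<^bsub>?L\<^esub> (y \<oplus>\<^bsub>?L\<^esub> z)"
    using a b c by (simp add: simps m_assoc)
  \<comment> \<open>The two sides of the distributive law have denominators that differ by a factor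
    \<open>u\<close>; \<open>frac_cong_scale\<close> absorbs it.\<close>
  have "a \<otimes> c \<otimes> (t \<otimes> u) \<oplus> b \<otimes> c \<otimes> (s \<otimes> u) = (a \<otimes> t \<oplus> b \<otimes> s) \<otimes> c \<otimes> u"
    "s \<otimes> u \<otimes> (t \<otimes> u) = s \<otimes> t \<otimes> u \<otimes> u"
    using a(1) b(1) c(1) stu by algebra+
  then show "(x \<oplus>\<^bsub>?L\<^esub> y) \<otimes>\<^bsub>?L\<^esub> z = x \<otimes>\<^bsub>?L\<^esub> z \<oplus>\<^bsub>?L\<^esub> y \<otimes>\<^bsub>?L\<^esub> z"
    using a b c frac_cong_scale[of "(a \<otimes> t \<oplus> b \<otimes> s) \<otimes> c" "s \<otimes> t \<otimes> u" u]
    by (simp add: simps)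
qed (auto simp: localization_one localization_zero frac_closed one_S)

text \<open>Two principal ideals of the localization are comparable, so one of \<open>a/1\<close>,
  \<open>b/1\<close> is a multiple of the other; clearing denominators moves this into
  \<open>R\<close>. Later arguments work only with such relations \<open>s a = r b\<close>.\<close>

lemma valuation_localization_comparable:
  assumes val: "valuation_ring (localization R S)" and "a \<in> carrier R" "b \<in> carrier R"
  shows "\<exists>s\<in>S. \<exists>r\<in>carrier R. s \<otimes> a = r \<otimes> b \<or> s \<otimes> b = r \<otimes> a"
proof -
  let ?L = "localization R S"
  interpret L: cring ?L by (rule cring_localization)
  have key: "\<exists>s\<in>S. \<exists>r\<in>carrier R. s \<otimes> x = r \<otimes> y"
    if xy: "x \<in> carrier R" "y \<in> carrier R"
      and sub: "PIdl\<^bsub>?L\<^esub> (frac x \<one>) \<subseteq> PIdl\<^bsub>?L\<^esub> (frac y \<one>)" for x y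
  proof -
    have "frac x \<one> \<in> PIdl\<^bsub>?L\<^esub> (frac y \<one>)"
      using sub L.cgenideal_self[OF frac_closed[OF xy(1) one_S]] by blast
    then obtain z where z: "z \<in> carrier ?L" "frac x \<one> = z \<otimes>\<^bsub>?L\<^esub> frac y \<one>"
      by (auto simp: cgenideal_def)
    obtain r s where rs: "r \<in> carrier R" "s \<in> S" "z = frac r s"
      using localization_cases[OF z(1)] .
    have "frac x \<one> = frac (r \<otimes> y) s"
      using z rs xy one_S by (simp add: localization_mult)
    then obtain t where t: "t \<in> S" "t \<otimes> (x \<otimes> s) = t \<otimes> (r \<otimes> y \<otimes> \<one>)"
      using rs xy one_S by (auto simp: frac_eq_iff)
    have "t \<otimes> s \<otimes> x = (t \<otimes> r) \<otimes> y"
      using t rs xy by (simp add: m_ac)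
    then show ?thesis
      using t rs xy by (intro bexI[of _ "t \<otimes> s"] bexI[of _ "t \<otimes> r"]) (auto intro: mult_S)
  qed
  have "ideal (PIdl\<^bsub>?L\<^esub> (frac a \<one>)) ?L" "ideal (PIdl\<^bsub>?L\<^esub> (frac b \<one>)) ?L"
    using assms one_S by (auto intro: L.cgenideal_ideal frac_closed)
  then have "PIdl\<^bsub>?L\<^esub> (frac a \<one>) \<subseteq> PIdl\<^bsub>?L\<^esub> (frac b \<one>) \<or> PIdl\<^bsub>?L\<^esub> (frac b \<one>) \<subseteq> PIdl\<^bsub>?L\<^esub> (frac a \<one>)"
    using val unfolding valuation_ring_def by blast
  then show ?thesis
    using key[OF assms(2,3)] key[OF assms(3,2)] by blast
qed

end


section \<open>Prime and maximal ideals\<close>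

lemma primeideal_one_notin:
  assumes "primeideal M R"
  shows "\<one>\<^bsub>R\<^esub> \<notin> M"
proof -
  interpret primeideal M R by fact
  show ?thesis using I_notcarr one_imp_carrier by blast
qed

lemma primeideal_mult_set:
  fixes R :: "'a ring" (structure)
  assumes "primeideal M R"
  shows "mult_set R (carrier R - M)"
proof -
  interpret primeideal M R by fact
  show ?thesis
    by unfold_locales (use I_prime primeideal_one_notin[OF assms] in auto)
qed

lemma arithmetic_comparable:
  fixes R :: "'a ring" (structure)
  assumes "arithmetic_ring R" "maximalideal M R" "a \<in> carrier R" "b \<in> carrier R"
  shows "\<exists>s\<in>carrier R - M. \<exists>r\<in>carrier R. s \<otimes> a = r \<otimes> b \<or> s \<otimes> b = r \<otimes> a"
proof -
  interpret cring R using assms by (simp add: arithmetic_ring_def)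
  interpret mult_set R "carrier R - M"
    using primeideal_mult_set maximalideal_prime assms by blast
  show ?thesis
    using valuation_localization_comparable assms
    by (auto simp: arithmetic_ring_def localization_at_def)
qed

text \<open>Zorn's lemma for the ideals that contain \<open>I\<close> but not \<open>\<one>\<close>:
  the union of a nonempty chain stays an ideal because any two of its elements lie in a common
  member.\<close>

lemma (in ring) exists_maximalideal:
  assumes I: "ideal I R" and one: "\<one> \<notin> I"
  shows "\<exists>M. maximalideal M R \<and> I \<subseteq> M"
proof -
  define A where "A = {J. ideal J R \<and> I \<subseteq> J \<and> \<one> \<notin> J}"
  have "\<exists>M\<in>A. \<forall>N\<in>A. M \<subseteq> N \<longrightarrow> N = M"
  proof (rule subset_Zorn_nonempty)
    show "A \<noteq> {}" using assms unfolding A_def by blast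
    fix C assume ne: "C \<noteq> {}" and chain: "subset.chain A C"
    then have C: "\<And>J. J \<in> C \<Longrightarrow> ideal J R \<and> I \<subseteq> J \<and> \<one> \<notin> J"
      and tot: "\<And>J K. J \<in> C \<Longrightarrow> K \<in> C \<Longrightarrow> J \<subseteq> K \<or> K \<subseteq> J"
      by (auto simp: subset_chain_def A_def)
    have cl: "J \<subseteq> carrier R" "\<zero> \<in> J" "\<And>x y. x \<in> J \<Longrightarrow> y \<in> J \<Longrightarrow> x \<oplus> y \<in> J"
      "\<And>x. x \<in> J \<Longrightarrow> \<ominus> x \<in> J"
      "\<And>x y. x \<in> J \<Longrightarrow> y \<in> carrier R \<Longrightarrow> y \<otimes> x \<in> J \<and> x \<otimes> y \<in> J" if "J \<in> C" for J
    proof -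
      interpret J: ideal J R using C that by blast
      show "J \<subseteq> carrier R" "\<zero> \<in> J" "\<And>x y. x \<in> J \<Longrightarrow> y \<in> J \<Longrightarrow> x \<oplus> y \<in> J"
        "\<And>x. x \<in> J \<Longrightarrow> \<ominus> x \<in> J"
        "\<And>x y. x \<in> J \<Longrightarrow> y \<in> carrier R \<Longrightarrow> y \<otimes> x \<in> J \<and> x \<otimes> y \<in> J"
        using J.a_subset by (auto simp: J.I_l_closed J.I_r_closed)
    qed
    have "ideal (\<Union>C) R"
    proof (rule idealI[OF ring_axioms])
      show "subgroup (\<Union>C) (add_monoid R)"
      proof (rule add.subgroupI)
        show "\<Union>C \<subseteq> carrier R" using cl(1) by blast
        show "\<Union>C \<noteq> {}" using ne cl(2) by blast
        show "\<And>a. a \<in> \<Union>C \<Longrightarrow> \<ominus> a \<in> \<Union>C" using cl(4) by blast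
        fix a b assume "a \<in> \<Union>C" "b \<in> \<Union>C"
        then obtain J K where JK: "J \<in> C" "a \<in> J" "K \<in> C" "b \<in> K" by blast
        then show "a \<oplus> b \<in> \<Union>C"
          using tot[OF JK(1,3)] cl(3)[OF JK(1)] cl(3)[OF JK(3)] by blast
      qed
    next
      fix a r assume "a \<in> \<Union>C" "r \<in> carrier R"
      then obtain J where J: "J \<in> C" "a \<in> J" by blast
      then show "r \<otimes> a \<in> \<Union>C" "a \<otimes> r \<in> \<Union>C"
        using cl(5)[OF J \<open>r \<in> carrier R\<close>] by blast+
    qed
    then show "\<Union>C \<in> A" using C ne unfolding A_def by blast
  qed
  then obtain M where "M \<in> A" and max_A: "\<forall>N\<in>A. M \<subseteq> N \<longrightarrow> N = M" by (rule bexE)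
  then have M: "ideal M R" "I \<subseteq> M" "\<one> \<notin> M" by (simp_all add: A_def)
  have "maximalideal M R"
  proof (rule maximalidealI[OF M(1)])
    show "carrier R \<noteq> M" using M(3) one_closed by blast
    fix J assume J: "ideal J R" "M \<subseteq> J" "J \<subseteq> carrier R"
    show "J = M \<or> J = carrier R"
    proof (cases "\<one> \<in> J")
      case True
      then show ?thesis using ideal.one_imp_carrier[OF J(1)] by simp
    next
      case False
      then have "J \<in> A" using J M(2) unfolding A_def by simp
      then show ?thesis using max_A J(2) by simp
    qed
  qed
  with M(2) show ?thesis by blast
qed

section \<open>Local finite generation\<close>

context cring
begin

abbreviation vadd :: "('i \<Rightarrow> 'a) \<Rightarrow> ('i \<Rightarrow> 'a) \<Rightarrow> 'i \<Rightarrow> 'a" where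
  "vadd x y \<equiv> (\<lambda>i. x i \<oplus> y i)"

abbreviation vscale :: "'a \<Rightarrow> ('i \<Rightarrow> 'a) \<Rightarrow> 'i \<Rightarrow> 'a" where
  "vscale r x \<equiv> (\<lambda>i. r \<otimes> x i)"

text \<open>Bare sets of functions replace module records: kernels for varying index sets and
  annihilators then all live in one type.\<close>

definition fun_submodule :: "('i \<Rightarrow> 'a) set \<Rightarrow> bool" where
  "fun_submodule K \<longleftrightarrow> K \<subseteq> UNIV \<rightarrow> carrier R \<and> (\<lambda>i. \<zero>) \<in> K \<and>
     (\<forall>x\<in>K. \<forall>y\<in>K. vadd x y \<in> K) \<and> (\<forall>r\<in>carrier R. \<forall>x\<in>K. vscale r x \<in> K)"

definition fun_linear :: "('i \<Rightarrow> 'a) set \<Rightarrow> ('j \<Rightarrow> 'a) set \<Rightarrow> (('i \<Rightarrow> 'a) \<Rightarrow> 'j \<Rightarrow> 'a) \<Rightarrow> bool" where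
  "fun_linear K L f \<longleftrightarrow> f \<in> K \<rightarrow> L \<and> (\<forall>x\<in>K. \<forall>y\<in>K. f (vadd x y) = vadd (f x) (f y)) \<and>
     (\<forall>r\<in>carrier R. \<forall>x\<in>K. f (vscale r x) = vscale r (f x))"

text \<open>Building combinations one multiple at a time replaces finite sums by rule
  induction.\<close>

inductive_set fun_span :: "('i \<Rightarrow> 'a) set \<Rightarrow> ('i \<Rightarrow> 'a) set" for G where
  zero: "(\<lambda>i. \<zero>) \<in> fun_span G"
| step: "\<lbrakk>r \<in> carrier R; g \<in> G; v \<in> fun_span G\<rbrakk> \<Longrightarrow> vadd (vscale r g) v \<in> fun_span G"

lemma fun_submoduleD:
  assumes "fun_submodule K"
  shows "x \<in> K \<Longrightarrow> x i \<in> carrier R" "(\<lambda>i. \<zero>) \<in> K"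
    "\<lbrakk>x \<in> K; y \<in> K\<rbrakk> \<Longrightarrow> vadd x y \<in> K" "\<lbrakk>r \<in> carrier R; x \<in> K\<rbrakk> \<Longrightarrow> vscale r x \<in> K"
  using assms by (auto simp: fun_submodule_def)

lemma fun_linearD:
  assumes "fun_linear K L f"
  shows "x \<in> K \<Longrightarrow> f x \<in> L" "\<lbrakk>x \<in> K; y \<in> K\<rbrakk> \<Longrightarrow> f (vadd x y) = vadd (f x) (f y)"
    "\<lbrakk>r \<in> carrier R; x \<in> K\<rbrakk> \<Longrightarrow> f (vscale r x) = vscale r (f x)"
  using assms by (auto simp: fun_linear_def)

lemma fun_linear_zero:
  assumes "fun_submodule K" "fun_submodule L" "fun_linear K L f"
  shows "f (\<lambda>i. \<zero>) = (\<lambda>i. \<zero>)"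
proof -
  have z: "(\<lambda>i. \<zero>) \<in> K" using fun_submoduleD(2)[OF assms(1)] .
  then have "f (\<lambda>i. \<zero>) j \<in> carrier R" for j
    using fun_linearD(1)[OF assms(3)] fun_submoduleD(1)[OF assms(2)] by blast
  then show ?thesis
    using fun_linearD(3)[OF assms(3) zero_closed z] by simp
qed

lemma fun_span_subset:
  assumes "fun_submodule K" "G \<subseteq> K" "v \<in> fun_span G"
  shows "v \<in> K"
  using assms(3) by induction (use assms(2) fun_submoduleD[OF assms(1)] in auto)

lemma fun_span_closed:
  assumes "G \<subseteq> UNIV \<rightarrow> carrier R" "v \<in> fun_span G"
  shows "v i \<in> carrier R"
proof -
  have "fun_submodule (UNIV \<rightarrow> carrier R)" by (auto simp: fun_submodule_def)
  from fun_span_subset[OF this assms] show ?thesis by auto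
qed

lemma fun_span_mono: "\<lbrakk>v \<in> fun_span G; G \<subseteq> H\<rbrakk> \<Longrightarrow> v \<in> fun_span H"
  by (induction rule: fun_span.induct) (auto intro: fun_span.intros)

lemma fun_span_add:
  assumes "G \<subseteq> UNIV \<rightarrow> carrier R" "v \<in> fun_span G" "w \<in> fun_span G"
  shows "vadd v w \<in> fun_span G"
proof -
  note car = fun_span_closed[OF assms(1)]
  show ?thesis
    using assms(2)
  proof induction
    case zero
    then show ?case using assms(3) car[OF assms(3)] by simp
  next
    case (step r g v)
    have "g i \<in> carrier R" for i using step(2) assms(1) by auto
    then have "vadd (vadd (vscale r g) v) w = vadd (vscale r g) (vadd v w)"
      using step(1) car[OF step(3)] car[OF assms(3)] by (simp add: a_assoc)
    then show ?case using fun_span.step[OF step(1,2,4)] by simp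
  qed
qed

lemma fun_span_scale:
  assumes "G \<subseteq> UNIV \<rightarrow> carrier R" "v \<in> fun_span G" "r \<in> carrier R"
  shows "vscale r v \<in> fun_span G"
proof -
  note car = fun_span_closed[OF assms(1)]
  show ?thesis
    using assms(2)
  proof induction
    case zero
    then show ?case using fun_span.zero assms(3) by simp
  next
    case (step q g v)
    have "g i \<in> carrier R" for i using step(2) assms(1) by auto
    then have "vscale r (vadd (vscale q g) v) = vadd (vscale (r \<otimes> q) g) (vscale r v)"
      using step(1) car[OF step(3)] assms(3) by (simp add: r_distr m_assoc)
    then show ?case using fun_span.step[OF _ step(2,4), of "r \<otimes> q"] step(1) assms(3) by simp
  qed
qed

lemma fun_span_image:
  assumes "fun_submodule K" "fun_submodule L" "fun_linear K L f" "G \<subseteq> K" "v \<in> fun_span G"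
  shows "f v \<in> fun_span (f ` G)"
  using assms(5)
proof induction
  case zero
  then show ?case using fun_linear_zero[OF assms(1-3)] fun_span.zero by simp
next
  case (step r g v)
  have g: "g \<in> K" "vscale r g \<in> K" and v: "v \<in> K"
    using step assms(4) fun_submoduleD(4)[OF assms(1)] fun_span_subset[OF assms(1,4)] by auto
  have "f (vadd (vscale r g) v) = vadd (vscale r (f g)) (f v)"
    using fun_linearD(2)[OF assms(3) g(2) v] fun_linearD(3)[OF assms(3) step(1) g(1)] by simp
  then show ?case using fun_span.step[OF step(1) _ step(4), of "f g"] step(2) by simp
qed

text \<open>The elements \<open>s\<close> such that \<open>K\<close> becomes finitely generated after inverting \<open>s\<close>, with a
  uniform denominator; \<open>K\<close> is finitely generated iff \<open>\<one>\<close> belongs to this ideal.\<close>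

definition fg_ideal :: "('i \<Rightarrow> 'a) set \<Rightarrow> 'a set" where
  "fg_ideal K = {s \<in> carrier R. \<exists>G. finite G \<and> G \<subseteq> K \<and> (\<forall>x\<in>K. vscale s x \<in> fun_span G)}"

text \<open>\<open>r x\<close> is a sum of images of elements of \<open>L1\<close> and
  \<open>L2\<close>, which \<open>g1\<close> and \<open>g2\<close> select; after multiplication by
  \<open>s t\<close> the images of the two finite generating sets reach it.\<close>

lemma fg_ideal_combine:
  assumes K: "fun_submodule K" and L1: "fun_submodule L1" and L2: "fun_submodule L2"
    and f1: "fun_linear L1 K f1" and f2: "fun_linear L2 K f2"
    and g1: "g1 \<in> K \<rightarrow> L1" and g2: "g2 \<in> K \<rightarrow> L2"
    and r: "r \<in> carrier R" "\<And>x. x \<in> K \<Longrightarrow> vscale r x = vadd (f1 (g1 x)) (f2 (g2 x))"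
    and s: "s \<in> fg_ideal L1" and t: "t \<in> fg_ideal L2"
  shows "s \<otimes> t \<otimes> r \<in> fg_ideal K"
proof -
  obtain G where G: "s \<in> carrier R" "finite G" "G \<subseteq> L1" "\<And>x. x \<in> L1 \<Longrightarrow> vscale s x \<in> fun_span G"
    using s by (auto simp: fg_ideal_def)
  obtain H where H: "t \<in> carrier R" "finite H" "H \<subseteq> L2" "\<And>x. x \<in> L2 \<Longrightarrow> vscale t x \<in> fun_span H"
    using t by (auto simp: fg_ideal_def)
  let ?U = "f1 ` G \<union> f2 ` H"
  have U: "finite ?U" "?U \<subseteq> K"
    using G H fun_linearD(1)[OF f1] fun_linearD(1)[OF f2] by auto
  then have U': "?U \<subseteq> UNIV \<rightarrow> carrier R" using order_trans[OF U(2)] K by (simp add: fun_submodule_def)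
  have "vscale (s \<otimes> t \<otimes> r) x \<in> fun_span ?U" if x: "x \<in> K" for x
  proof -
    have gx: "g1 x \<in> L1" "g2 x \<in> L2" using g1 g2 x by auto
    have fx: "f1 (g1 x) \<in> K" "f2 (g2 x) \<in> K"
      using gx fun_linearD(1)[OF f1] fun_linearD(1)[OF f2] by auto
    note car = fun_submoduleD(1)[OF K x] fx[THEN fun_submoduleD(1)[OF K]]
    have "vscale s (f1 (g1 x)) \<in> fun_span ?U"
      using fun_span_image[OF L1 K f1 G(3) G(4)[OF gx(1)]] fun_linearD(3)[OF f1 G(1) gx(1)]
      by (auto elim: fun_span_mono)
    moreover have "vscale t (f2 (g2 x)) \<in> fun_span ?U"
      using fun_span_image[OF L2 K f2 H(3) H(4)[OF gx(2)]] fun_linearD(3)[OF f2 H(1) gx(2)]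
      by (auto elim: fun_span_mono)
    \<comment> \<open>The extra factors \<open>t\<close> and \<open>s\<close> bring the two summands
      to the common denominator \<open>s t\<close>.\<close>
    ultimately have "vadd (vscale t (vscale s (f1 (g1 x)))) (vscale s (vscale t (f2 (g2 x)))) \<in> fun_span ?U"
      using fun_span_add[OF U' fun_span_scale[OF U' _ H(1)] fun_span_scale[OF U' _ G(1)]] by blast
    moreover have "vscale (s \<otimes> t \<otimes> r) x = vadd (vscale t (vscale s (f1 (g1 x)))) (vscale s (vscale t (f2 (g2 x))))"
    proof
      fix i
      have "s \<otimes> t \<otimes> r \<otimes> x i = s \<otimes> t \<otimes> (r \<otimes> x i)"
        using G(1) H(1) r(1) car by (simp add: m_assoc)
      also have "r \<otimes> x i = f1 (g1 x) i \<oplus> f2 (g2 x) i"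
        using r(2)[OF x] by (rule fun_cong)
      finally show "s \<otimes> t \<otimes> r \<otimes> x i = t \<otimes> (s \<otimes> f1 (g1 x) i) \<oplus> s \<otimes> (t \<otimes> f2 (g2 x) i)"
        using G(1) H(1) car by (simp add: r_distr m_ac)
    qed
    ultimately show ?thesis by simp
  qed
  then show ?thesis
    using U G(1) H(1) r(1) unfolding fg_ideal_def by blast
qed

text \<open>Sums use the union of the two generating sets, as \<open>(a + b) x = a x + b x\<close>.
  Being an ideal is what allows denominators found at different maximal ideals to be combined into
  \<open>\<one>\<close>.\<close>

lemma ideal_fg_ideal:
  assumes K: "fun_submodule K"
  shows "ideal (fg_ideal K) R"
proof (rule idealI[OF ring_axioms])
  have mult: "r \<otimes> a \<in> fg_ideal K" if a: "a \<in> fg_ideal K" and r: "r \<in> carrier R" for a r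
  proof -
    obtain G where G: "a \<in> carrier R" "finite G" "G \<subseteq> K" "\<And>x. x \<in> K \<Longrightarrow> vscale a x \<in> fun_span G"
      using a by (auto simp: fg_ideal_def)
    have "vscale (r \<otimes> a) x \<in> fun_span G" if x: "x \<in> K" for x
    proof -
      have "vscale (r \<otimes> a) x = vscale r (vscale a x)"
        using G(1) r fun_submoduleD(1)[OF K x] by (simp add: m_assoc)
      moreover have "G \<subseteq> UNIV \<rightarrow> carrier R" using G(3) K by (auto simp: fun_submodule_def)
      ultimately show ?thesis using fun_span_scale[OF _ G(4)[OF x] r] by simp
    qed
    then show ?thesis using G r unfolding fg_ideal_def by blast
  qed
  then show "r \<otimes> a \<in> fg_ideal K" "a \<otimes> r \<in> fg_ideal K"
    if "a \<in> fg_ideal K" "r \<in> carrier R" for a r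
    using that m_comm[of a r] unfolding fg_ideal_def by auto
  show "subgroup (fg_ideal K) (add_monoid R)"
  proof (rule add.subgroupI)
    show "fg_ideal K \<subseteq> carrier R" by (auto simp: fg_ideal_def)
    have "vscale \<zero> x \<in> fun_span {}" if "x \<in> K" for x
      using fun_submoduleD(1)[OF K that] fun_span.zero by simp
    then have "\<zero> \<in> fg_ideal K" unfolding fg_ideal_def by blast
    then show "fg_ideal K \<noteq> {}" by blast
  next
    fix a assume a: "a \<in> fg_ideal K"
    then have "\<ominus> \<one> \<otimes> a \<in> fg_ideal K" by (rule mult) simp
    then show "\<ominus> a \<in> fg_ideal K" using a by (simp add: fg_ideal_def l_minus)
  next
    fix a b assume a: "a \<in> fg_ideal K" and b: "b \<in> fg_ideal K"
    obtain G where G: "a \<in> carrier R" "finite G" "G \<subseteq> K" "\<And>x. x \<in> K \<Longrightarrow> vscale a x \<in> fun_span G"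
      using a by (auto simp: fg_ideal_def)
    obtain H where H: "b \<in> carrier R" "finite H" "H \<subseteq> K" "\<And>x. x \<in> K \<Longrightarrow> vscale b x \<in> fun_span H"
      using b by (auto simp: fg_ideal_def)
    have "vscale (a \<oplus> b) x \<in> fun_span (G \<union> H)" if x: "x \<in> K" for x
    proof -
      have "vscale (a \<oplus> b) x = vadd (vscale a x) (vscale b x)"
        using G(1) H(1) fun_submoduleD(1)[OF K x] by (simp add: l_distr)
      moreover have "G \<union> H \<subseteq> UNIV \<rightarrow> carrier R" using G(3) H(3) K by (auto simp: fun_submodule_def)
      ultimately show ?thesis
        using fun_span_add[OF _ fun_span_mono[OF G(4)[OF x]] fun_span_mono[OF H(4)[OF x]], of "G \<union> H"]
        by simp
    qed
    then show "a \<oplus> b \<in> fg_ideal K"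
      using G H unfolding fg_ideal_def by (auto intro!: exI[of _ "G \<union> H"])
  qed
qed

text \<open>A proper ideal would lie in some maximal ideal. This is the passage from local to global
  finite generation.\<close>

lemma one_in_fg_idealI_local:
  assumes "fun_submodule K" "\<And>M. maximalideal M R \<Longrightarrow> \<not> fg_ideal K \<subseteq> M"
  shows "\<one> \<in> fg_ideal K"
  using exists_maximalideal[OF ideal_fg_ideal[OF assms(1)]] assms(2) by blast

section \<open>Kernels of matrices and annihilators\<close>

definition vecs :: "nat set \<Rightarrow> (nat \<Rightarrow> 'a) set" where
  "vecs J = {v. (\<forall>i\<in>J. v i \<in> carrier R) \<and> (\<forall>i. i \<notin> J \<longrightarrow> v i = \<zero>)}"

text \<open>Index sets are arbitrary sets of naturals and vectors vanish outside them, so deleting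
  the pivot row and column needs no renumbering.\<close>

definition mat_ker :: "(nat \<Rightarrow> nat \<Rightarrow> 'a) \<Rightarrow> nat set \<Rightarrow> nat set \<Rightarrow> (nat \<Rightarrow> 'a) set" where
  "mat_ker A I J = {x \<in> vecs J. \<forall>i\<in>I. (\<Oplus>j\<in>J. A i j \<otimes> x j) = \<zero>}"

lemma vecs_closed: "x \<in> vecs J \<Longrightarrow> x i \<in> carrier R"
  by (cases "i \<in> J") (auto simp: vecs_def)

lemma fun_submodule_vecs: "fun_submodule (vecs J)"
  using vecs_closed by (auto simp: fun_submodule_def vecs_def)

lemma fun_submodule_mat_ker:
  assumes J: "finite J" and A: "\<And>i j. A i j \<in> carrier R"
  shows "fun_submodule (mat_ker A I J)"
  unfolding fun_submodule_def
proof (intro conjI ballI)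
  show "mat_ker A I J \<subseteq> UNIV \<rightarrow> carrier R"
    using vecs_closed by (auto simp: mat_ker_def)
  have "(\<Oplus>j\<in>J. A i j \<otimes> \<zero>) = \<zero>" for i
    using A finsum_zero by (simp cong: finsum_cong)
  then show "(\<lambda>i. \<zero>) \<in> mat_ker A I J"
    by (simp add: mat_ker_def vecs_def)
next
  fix x y assume x: "x \<in> mat_ker A I J" and y: "y \<in> mat_ker A I J"
  then have xy: "x \<in> vecs J" "y \<in> vecs J" by (auto simp: mat_ker_def)
  note car = xy[THEN vecs_closed]
  have "(\<Oplus>j\<in>J. A i j \<otimes> (x j \<oplus> y j)) = (\<Oplus>j\<in>J. A i j \<otimes> x j) \<oplus> (\<Oplus>j\<in>J. A i j \<otimes> y j)" for i
    using A car by (simp add: r_distr finsum_addf)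
  then show "vadd x y \<in> mat_ker A I J"
    using x y fun_submoduleD(3)[OF fun_submodule_vecs xy] by (simp add: mat_ker_def)
next
  fix r x assume r: "r \<in> carrier R" and x: "x \<in> mat_ker A I J"
  then have xJ: "x \<in> vecs J" by (auto simp: mat_ker_def)
  have "(\<Oplus>j\<in>J. A i j \<otimes> (r \<otimes> x j)) = r \<otimes> (\<Oplus>j\<in>J. A i j \<otimes> x j)" for i
    using A vecs_closed[OF xJ] r J by (simp add: finsum_rdistr m_lcomm)
  then show "vscale r x \<in> mat_ker A I J"
    using x r fun_submoduleD(4)[OF fun_submodule_vecs r xJ] by (simp add: mat_ker_def)
qed

text \<open>Up to the factor \<open>r\<close>, \<open>K\<close> is a retract of \<open>L\<close>.
  This is \<open>fg_ideal_combine\<close> with \<open>L\<close> used twice and the second map zero,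
  whence the square of \<open>s\<close>.\<close>

lemma fg_ideal_retract:
  assumes K: "fun_submodule K" and L: "fun_submodule L"
    and f: "fun_linear L K f" and g: "g \<in> K \<rightarrow> L"
    and r: "r \<in> carrier R" "\<And>x. x \<in> K \<Longrightarrow> vscale r x = f (g x)" and s: "s \<in> fg_ideal L"
  shows "s \<otimes> s \<otimes> r \<in> fg_ideal K"
proof (rule fg_ideal_combine[OF K L L f _ g g r(1) _ s s])
  show "fun_linear L K (\<lambda>x i. \<zero>)"
    using fun_submoduleD(2)[OF K] by (auto simp: fun_linear_def)
  fix x assume x: "x \<in> K"
  then have "f (g x) i \<in> carrier R" for i
    using fun_linearD(1)[OF f] g fun_submoduleD(1)[OF K] by blast
  then show "vscale r x = vadd (f (g x)) (\<lambda>i. \<zero>)"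
    using r(2)[OF x] by simp
qed

text \<open>The annihilator of \<open>a\<close> is encoded by functions supported at index 0, so
  that \<open>fun_submodule\<close> and \<open>fg_ideal\<close> apply to it.\<close>

definition ann_vecs :: "'a \<Rightarrow> (nat \<Rightarrow> 'a) set" where
  "ann_vecs a = {v \<in> vecs {0}. a \<otimes> v 0 = \<zero>}"

lemma fun_submodule_ann_vecs:
  assumes a: "a \<in> carrier R"
  shows "fun_submodule (ann_vecs a)"
  unfolding fun_submodule_def
proof (intro conjI ballI)
  show "ann_vecs a \<subseteq> UNIV \<rightarrow> carrier R" "(\<lambda>i. \<zero>) \<in> ann_vecs a"
    using vecs_closed[of _ "{0}"] a by (fastforce simp: ann_vecs_def, simp add: ann_vecs_def vecs_def)
next
  fix x y assume "x \<in> ann_vecs a" "y \<in> ann_vecs a"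
  then show "vadd x y \<in> ann_vecs a"
    using a by (auto simp: ann_vecs_def vecs_def r_distr)
next
  fix r x assume "r \<in> carrier R" "x \<in> ann_vecs a"
  then show "vscale r x \<in> ann_vecs a"
    using a by (auto simp: ann_vecs_def vecs_def m_lcomm[of a r])
qed

end

section \<open>Gaussian elimination\<close>

text \<open>After inverting \<open>s\<close>, the entry at \<open>(p, q)\<close> divides every
  entry, with quotients \<open>c i j / s\<close>. They are not unique when the pivot is a zero
  divisor, so \<open>c p q = s\<close> is imposed to make the quotient at the pivot equal to
  1.\<close>

locale pivot = cring +
  fixes A c :: "nat \<Rightarrow> nat \<Rightarrow> 'a" and I J :: "nat set" and p q :: nat and s :: 'a
  assumes A_closed [simp]: "A i j \<in> carrier R" and c_closed [simp]: "c i j \<in> carrier R"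
    and fin_I: "finite I" and fin_J: "finite J" and p: "p \<in> I" and q: "q \<in> J"
    and s_closed [simp]: "s \<in> carrier R" and c_pivot: "c p q = s"
    and pivot: "\<lbrakk>i \<in> I; j \<in> J\<rbrakk> \<Longrightarrow> s \<otimes> A i j = c i j \<otimes> A p q"
begin

text \<open>Up to multiplication by powers of \<open>s\<close>, the kernel of \<open>A\<close> is the product of the annihilator of the
  pivot and the kernel of the following Schur complement, whose formula is symmetric in rows and
  columns.\<close>

definition schur :: "nat \<Rightarrow> nat \<Rightarrow> 'a" where
  "schur i j = (s \<otimes> c i j \<ominus> c i q \<otimes> c p j) \<otimes> A p q"

lemma schur_closed [simp]: "schur i j \<in> carrier R"
  by (simp add: schur_def)

text \<open>Reads the symmetric formula as a row operation: a multiple of row \<open>p\<close> is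
  subtracted from a multiple of row \<open>i\<close>. Hence vectors killed by \<open>A\<close> are
  killed by \<open>schur\<close>.\<close>

lemma schur_eq:
  assumes "i \<in> I" "j \<in> J"
  shows "schur i j = s \<otimes> (s \<otimes> A i j) \<ominus> c i q \<otimes> (s \<otimes> A p j)"
proof -
  have "schur i j = s \<otimes> (c i j \<otimes> A p q) \<ominus> c i q \<otimes> (c p j \<otimes> A p q)"
    unfolding schur_def using A_closed c_closed s_closed by algebra
  then show ?thesis using assms p by (simp add: pivot)
qed

text \<open>Here and in the row version, the normalization \<open>c p q = s\<close> makes the two
  terms cancel.\<close>

lemma schur_pivot_col: "schur i q = \<zero>"
  unfolding schur_def c_pivot using A_closed c_closed s_closed by algebra

lemma schur_pivot_row: "schur p j = \<zero>"
  unfolding schur_def c_pivot using A_closed c_closed s_closed by algebra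

text \<open>The factor \<open>s\<close> makes this a kernel vector: \<open>s \<otimes> A i q\<close>
  is \<open>c i q\<close> times the pivot, and the pivot kills \<open>v 0\<close>.\<close>

definition emb_ann :: "(nat \<Rightarrow> 'a) \<Rightarrow> nat \<Rightarrow> 'a" where
  "emb_ann v = (\<lambda>j. if j = q then s \<otimes> v 0 else \<zero>)"

text \<open>The value at 0 is \<open>s\<close> times the new coordinate
  \<open>x q + sum (c p j / s) x j\<close>, summed over \<open>j\<close> other than
  \<open>q\<close>. The pivot times it is \<open>s\<close> times row \<open>p\<close> applied to
  \<open>x\<close>, so it lies in the annihilator.\<close>

definition proj_ann :: "(nat \<Rightarrow> 'a) \<Rightarrow> nat \<Rightarrow> 'a" where
  "proj_ann x = (\<lambda>i. if i = 0 then \<Oplus>j\<in>J. c p j \<otimes> x j else \<zero>)"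

text \<open>The coordinate at \<open>q\<close> is solved so that the new coordinate of
  \<open>proj_ann\<close> vanishes: it must be \<open>- sum (c p j / s) x j\<close>. Scaling the
  vector by the square of \<open>s\<close> clears the denominator.\<close>

definition emb_schur :: "(nat \<Rightarrow> 'a) \<Rightarrow> nat \<Rightarrow> 'a" where
  "emb_schur x = (\<lambda>j. if j = q then \<ominus> (s \<otimes> (\<Oplus>j\<in>J - {q}. c p j \<otimes> x j)) else s \<otimes> (s \<otimes> x j))"

definition proj_schur :: "(nat \<Rightarrow> 'a) \<Rightarrow> nat \<Rightarrow> 'a" where
  "proj_schur x = x(q := \<zero>)"

abbreviation "KA \<equiv> mat_ker A I J"
abbreviation "KS \<equiv> mat_ker schur (I - {p}) (J - {q})"
abbreviation "KN \<equiv> ann_vecs (A p q)"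

lemma submodules: "fun_submodule KA" "fun_submodule KS" "fun_submodule KN"
  using fin_J by (auto intro!: fun_submodule_mat_ker fun_submodule_ann_vecs)

lemma sum_split:
  assumes "f \<in> J \<rightarrow> carrier R"
  shows "(\<Oplus>j\<in>J. f j) = f q \<oplus> (\<Oplus>j\<in>J - {q}. f j)"
proof -
  have "(\<Oplus>j\<in>insert q (J - {q}). f j) = f q \<oplus> (\<Oplus>j\<in>J - {q}. f j)"
    using assms fin_J q by (intro finsum_insert) auto
  then show ?thesis using q by (simp add: insert_absorb)
qed

lemma emb_ann_linear: "fun_linear KN KA emb_ann"
  unfolding fun_linear_def
proof (intro conjI ballI funcsetI)
  fix v assume v: "v \<in> KN"
  note car = fun_submoduleD(1)[OF submodules(3) v]
  have "(\<Oplus>j\<in>J. A i j \<otimes> emb_ann v j) = \<zero>" if i: "i \<in> I" for i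
  proof -
    have "(\<Oplus>j\<in>J - {q}. A i j \<otimes> emb_ann v j) = (\<Oplus>j\<in>J - {q}. \<zero>)"
      by (rule finsum_cong') (auto simp: emb_ann_def)
    then have "(\<Oplus>j\<in>J. A i j \<otimes> emb_ann v j) = A i q \<otimes> (s \<otimes> v 0)"
      using sum_split[of "\<lambda>j. A i j \<otimes> emb_ann v j"] car by (simp add: emb_ann_def Pi_def)
    also have "\<dots> = (s \<otimes> A i q) \<otimes> v 0" using car by (simp add: m_ac)
    also have "\<dots> = c i q \<otimes> (A p q \<otimes> v 0)" using car i q by (simp add: pivot m_assoc)
    finally show ?thesis using v by (simp add: ann_vecs_def)
  qed
  then show "emb_ann v \<in> KA"
    using car q by (auto simp: mat_ker_def vecs_def emb_ann_def)
next
  fix x y assume "x \<in> KN" "y \<in> KN"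
  note car = this[THEN fun_submoduleD(1)[OF submodules(3)]]
  show "emb_ann (vadd x y) = vadd (emb_ann x) (emb_ann y)"
    using car by (auto simp: emb_ann_def r_distr)
next
  fix r x assume "r \<in> carrier R" "x \<in> KN"
  then show "emb_ann (vscale r x) = vscale r (emb_ann x)"
    using fun_submoduleD(1)[OF submodules(3)] by (auto simp: emb_ann_def m_lcomm)
qed

lemma proj_ann_linear: "fun_linear KA KN proj_ann"
  unfolding fun_linear_def
proof (intro conjI ballI funcsetI)
  fix x assume x: "x \<in> KA"
  note car = fun_submoduleD(1)[OF submodules(1) x]
  have "A p q \<otimes> (\<Oplus>j\<in>J. c p j \<otimes> x j) = (\<Oplus>j\<in>J. A p q \<otimes> (c p j \<otimes> x j))"
    using car fin_J by (simp add: finsum_rdistr)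
  also have "\<dots> = (\<Oplus>j\<in>J. s \<otimes> (A p j \<otimes> x j))"
  proof (rule finsum_cong')
    fix j assume j: "j \<in> J"
    have "A p q \<otimes> (c p j \<otimes> x j) = c p j \<otimes> A p q \<otimes> x j" using car by (simp add: m_ac)
    also have "\<dots> = s \<otimes> (A p j \<otimes> x j)" using car pivot[OF p j] by (simp flip: m_assoc)
    finally show "A p q \<otimes> (c p j \<otimes> x j) = s \<otimes> (A p j \<otimes> x j)" .
  qed (use car in auto)
  also have "\<dots> = s \<otimes> (\<Oplus>j\<in>J. A p j \<otimes> x j)"
    using car fin_J by (simp add: finsum_rdistr)
  also have "\<dots> = \<zero>" using x p by (simp add: mat_ker_def)
  finally show "proj_ann x \<in> KN"
    using car by (auto simp: proj_ann_def ann_vecs_def vecs_def)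
next
  fix x y assume "x \<in> KA" "y \<in> KA"
  note car = this[THEN fun_submoduleD(1)[OF submodules(1)]]
  show "proj_ann (vadd x y) = vadd (proj_ann x) (proj_ann y)"
    using car by (auto simp: proj_ann_def r_distr finsum_addf)
next
  fix r x assume "r \<in> carrier R" "x \<in> KA"
  then show "proj_ann (vscale r x) = vscale r (proj_ann x)"
    using fun_submoduleD(1)[OF submodules(1)] fin_J
    by (auto simp: proj_ann_def m_lcomm finsum_rdistr)
qed

lemma emb_schur_linear: "fun_linear KS KA emb_schur"
  unfolding fun_linear_def
proof (intro conjI ballI funcsetI)
  fix x assume x: "x \<in> KS"
  note car = fun_submoduleD(1)[OF submodules(2) x]
  have "(\<Oplus>j\<in>J. A i j \<otimes> emb_schur x j) = \<zero>" if i: "i \<in> I" for i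
  proof -
    let ?S = "\<Oplus>j\<in>J - {q}. c p j \<otimes> x j"
    have S: "?S \<in> carrier R" using car by simp
    have "A i q \<otimes> emb_schur x q = \<ominus> (c i q \<otimes> (A p q \<otimes> ?S))"
    proof -
      have "A i q \<otimes> emb_schur x q = \<ominus> ((s \<otimes> A i q) \<otimes> ?S)"
        unfolding emb_schur_def using S by (simp add: r_minus m_ac)
      then show ?thesis using S i q by (simp add: pivot m_assoc)
    qed
    also have "c i q \<otimes> (A p q \<otimes> ?S) = (\<Oplus>j\<in>J - {q}. c i q \<otimes> (A p q \<otimes> (c p j \<otimes> x j)))"
      using car fin_J by (simp add: finsum_rdistr)
    finally have 1: "A i q \<otimes> emb_schur x q = \<ominus> (\<Oplus>j\<in>J - {q}. c i q \<otimes> (A p q \<otimes> (c p j \<otimes> x j)))" .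
    have "(\<Oplus>j\<in>J - {q}. A i j \<otimes> emb_schur x j)
        = (\<Oplus>j\<in>J - {q}. schur i j \<otimes> x j \<oplus> c i q \<otimes> (A p q \<otimes> (c p j \<otimes> x j)))"
    proof (rule finsum_cong')
      fix j assume j: "j \<in> J - {q}"
      have "A i j \<otimes> emb_schur x j = (s \<otimes> A i j) \<otimes> (s \<otimes> x j)"
        using j car by (simp add: emb_schur_def m_ac)
      also have "\<dots> = (c i j \<otimes> A p q) \<otimes> (s \<otimes> x j)"
        using i j by (simp add: pivot)
      also have "\<dots> = schur i j \<otimes> x j \<oplus> c i q \<otimes> (A p q \<otimes> (c p j \<otimes> x j))"
        unfolding schur_def using car[of j] A_closed c_closed s_closed by algebra
      finally show "A i j \<otimes> emb_schur x j = schur i j \<otimes> x j \<oplus> c i q \<otimes> (A p q \<otimes> (c p j \<otimes> x j))" .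
    qed (use car in auto)
    also have "\<dots> = (\<Oplus>j\<in>J - {q}. schur i j \<otimes> x j) \<oplus> (\<Oplus>j\<in>J - {q}. c i q \<otimes> (A p q \<otimes> (c p j \<otimes> x j)))"
      using car by (simp add: finsum_addf)
    also have "(\<Oplus>j\<in>J - {q}. schur i j \<otimes> x j) = \<zero>"
    \<comment> \<open>Row \<open>p\<close> is absent from the conditions defining \<open>KS\<close>,
      but there the Schur complement vanishes identically.\<close>
    proof (cases "i = p")
      case True
      then show ?thesis using car by (simp add: schur_pivot_row)
    next
      case False
      then show ?thesis using x i by (simp add: mat_ker_def)
    qed
    finally have 2: "(\<Oplus>j\<in>J - {q}. A i j \<otimes> emb_schur x j)
        = (\<Oplus>j\<in>J - {q}. c i q \<otimes> (A p q \<otimes> (c p j \<otimes> x j)))"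
      using car by simp
    have "emb_schur x j \<in> carrier R" for j using car by (simp add: emb_schur_def)
    \<comment> \<open>The contribution of column \<open>q\<close> is the negative of that of all
      other columns.\<close>
    then show ?thesis
      using sum_split[of "\<lambda>j. A i j \<otimes> emb_schur x j"] car unfolding 1 2 by (simp add: l_neg)
  qed
  moreover have "emb_schur x \<in> vecs J"
    using x car q by (auto simp: mat_ker_def vecs_def emb_schur_def)
  ultimately show "emb_schur x \<in> KA"
    by (auto simp: mat_ker_def)
next
  fix x y assume "x \<in> KS" "y \<in> KS"
  note car = this[THEN fun_submoduleD(1)[OF submodules(2)]]
  show "emb_schur (vadd x y) = vadd (emb_schur x) (emb_schur y)"
    using car by (auto simp: emb_schur_def r_distr finsum_addf minus_add)
next
  fix r x assume "r \<in> carrier R" "x \<in> KS"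
  then show "emb_schur (vscale r x) = vscale r (emb_schur x)"
    using fun_submoduleD(1)[OF submodules(2)] fin_J
    by (auto simp: emb_schur_def m_lcomm r_minus finsum_rdistr)
qed

lemma proj_schur_linear: "fun_linear KA KS proj_schur"
  unfolding fun_linear_def
proof (intro conjI ballI funcsetI)
  fix x assume x: "x \<in> KA"
  note car = fun_submoduleD(1)[OF submodules(1) x]
  have "(\<Oplus>j\<in>J - {q}. schur i j \<otimes> proj_schur x j) = \<zero>" if i: "i \<in> I" for i
  proof -
    have "(\<Oplus>j\<in>J - {q}. schur i j \<otimes> proj_schur x j) = (\<Oplus>j\<in>J - {q}. schur i j \<otimes> x j)"
      using car by (intro finsum_cong') (auto simp: proj_schur_def)
    \<comment> \<open>Column \<open>q\<close> of the Schur complement is zero, so the sum may run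
      over all of \<open>J\<close> again.\<close>
    also have "\<dots> = (\<Oplus>j\<in>J. schur i j \<otimes> x j)"
      using car sum_split[of "\<lambda>j. schur i j \<otimes> x j"] by (simp add: schur_pivot_col)
    also have "\<dots> = (\<Oplus>j\<in>J. s \<otimes> (s \<otimes> (A i j \<otimes> x j)) \<oplus> (\<ominus> (c i q \<otimes> s)) \<otimes> (A p j \<otimes> x j))"
    proof (rule finsum_cong')
      fix j assume j: "j \<in> J"
      show "schur i j \<otimes> x j = s \<otimes> (s \<otimes> (A i j \<otimes> x j)) \<oplus> (\<ominus> (c i q \<otimes> s)) \<otimes> (A p j \<otimes> x j)"
        unfolding schur_eq[OF i j] using car[of j] A_closed c_closed s_closed by algebra
    qed (use car in auto)
    also have "\<dots> = s \<otimes> (s \<otimes> (\<Oplus>j\<in>J. A i j \<otimes> x j)) \<oplus> (\<ominus> (c i q \<otimes> s)) \<otimes> (\<Oplus>j\<in>J. A p j \<otimes> x j)"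
      using car fin_J by (simp add: finsum_addf finsum_rdistr)
    also have "\<dots> = \<zero>" using x i p by (simp add: mat_ker_def)
    finally show ?thesis .
  qed
  moreover have "proj_schur x \<in> vecs (J - {q})"
    using x car q by (auto simp: mat_ker_def vecs_def proj_schur_def)
  ultimately show "proj_schur x \<in> KS"
    by (auto simp: mat_ker_def)
next
  fix x y assume "x \<in> KA" "y \<in> KA"
  show "proj_schur (vadd x y) = vadd (proj_schur x) (proj_schur y)"
    by (auto simp: proj_schur_def)
next
  fix r x assume "r \<in> carrier R" "x \<in> KA"
  then show "proj_schur (vscale r x) = vscale r (proj_schur x)"
    by (auto simp: proj_schur_def)
qed

lemma proj_emb_ann:
  assumes "v \<in> KN"
  shows "vscale (s \<otimes> s) v = proj_ann (emb_ann v)"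
proof
  fix i
  note car = fun_submoduleD(1)[OF submodules(3) assms]
  have "(\<Oplus>j\<in>J - {q}. c p j \<otimes> emb_ann v j) = (\<Oplus>j\<in>J - {q}. \<zero>)"
    by (rule finsum_cong') (auto simp: emb_ann_def)
  then have "(\<Oplus>j\<in>J. c p j \<otimes> emb_ann v j) = s \<otimes> (s \<otimes> v 0)"
    using sum_split[of "\<lambda>j. c p j \<otimes> emb_ann v j"] car by (simp add: emb_ann_def c_pivot Pi_def)
  then show "s \<otimes> s \<otimes> v i = proj_ann (emb_ann v) i"
    using car assms by (auto simp: proj_ann_def ann_vecs_def vecs_def m_assoc)
qed

lemma proj_emb_schur:
  assumes "x \<in> KS"
  shows "vscale (s \<otimes> s) x = proj_schur (emb_schur x)"
  using fun_submoduleD(1)[OF submodules(2) assms] assms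
  by (auto simp: proj_schur_def emb_schur_def m_assoc mat_ker_def vecs_def)

text \<open>Together with the two preceding identities: after inverting \<open>s\<close>,
  \<open>KA\<close> is the direct sum of \<open>KN\<close> and \<open>KS\<close>.\<close>

lemma emb_proj_sum:
  assumes "x \<in> KA"
  shows "vscale (s \<otimes> s) x = vadd (emb_ann (proj_ann x)) (emb_schur (proj_schur x))"
proof
  fix j
  note car = fun_submoduleD(1)[OF submodules(1) assms]
  let ?S = "\<Oplus>j\<in>J - {q}. c p j \<otimes> x j"
  have S: "?S \<in> carrier R" using car by simp
  have alg: "s \<otimes> s \<otimes> u = s \<otimes> (s \<otimes> u \<oplus> v) \<oplus> \<ominus> (s \<otimes> v)"
    if "u \<in> carrier R" "v \<in> carrier R" for u v
    using that s_closed by algebra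
  show "s \<otimes> s \<otimes> x j = emb_ann (proj_ann x) j \<oplus> emb_schur (proj_schur x) j"
  proof (cases "j = q")
    case True
    have "(\<Oplus>j\<in>J - {q}. c p j \<otimes> proj_schur x j) = ?S"
      using car by (intro finsum_cong') (auto simp: proj_schur_def)
    moreover have "(\<Oplus>j\<in>J. c p j \<otimes> x j) = s \<otimes> x q \<oplus> ?S"
      using car sum_split[of "\<lambda>j. c p j \<otimes> x j"] by (simp add: c_pivot)
    moreover have "s \<otimes> s \<otimes> x q = s \<otimes> (s \<otimes> x q \<oplus> ?S) \<oplus> \<ominus> (s \<otimes> ?S)"
      using alg[OF car S] .
    ultimately show ?thesis
      using True by (simp add: emb_ann_def proj_ann_def emb_schur_def)
  next
    case False
    then show ?thesis
      using car by (simp add: emb_ann_def emb_schur_def proj_schur_def m_assoc)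
  qed
qed

text \<open>\<open>KN\<close> and \<open>KS\<close> are retracts of \<open>KA\<close> up to the
  square of \<open>s\<close>, and \<open>KA\<close> is their sum up to the same factor. As
  \<open>M\<close> is prime, the resulting products of elements outside \<open>M\<close> stay
  outside \<open>M\<close>.\<close>

lemma fg_mat_ker_pivot:
  assumes M: "primeideal M R" and "s \<notin> M"
  shows "\<not> fg_ideal KA \<subseteq> M \<longleftrightarrow> \<not> fg_ideal KN \<subseteq> M \<and> \<not> fg_ideal KS \<subseteq> M"
proof -
  have carr: "x \<in> carrier R" if "x \<in> fg_ideal K" for x and K :: "(nat \<Rightarrow> 'a) set"
    using that by (simp add: fg_ideal_def)
  have prod: "x \<otimes> y \<otimes> (s \<otimes> s) \<notin> M" if "x \<in> carrier R" "y \<in> carrier R" "x \<notin> M" "y \<notin> M" for x y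
    using that primeideal.I_prime[OF M] \<open>s \<notin> M\<close> by (meson m_closed s_closed)
  have ss: "s \<otimes> s \<in> carrier R" by simp
  note lin = emb_ann_linear proj_ann_linear emb_schur_linear proj_schur_linear
  note fs = lin[unfolded fun_linear_def, THEN conjunct1]
  show ?thesis
  proof (intro iffI conjI)
    assume "\<not> fg_ideal KA \<subseteq> M"
    then obtain t where t: "t \<in> fg_ideal KA" "t \<notin> M" by blast
    have "t \<otimes> t \<otimes> (s \<otimes> s) \<in> fg_ideal KN"
      by (rule fg_ideal_retract[OF submodules(3,1) lin(2) fs(1) ss proj_emb_ann t(1)])
    then show "\<not> fg_ideal KN \<subseteq> M" using prod[OF t(1)[THEN carr] t(1)[THEN carr] t(2,2)] by blast
    have "t \<otimes> t \<otimes> (s \<otimes> s) \<in> fg_ideal KS"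
      by (rule fg_ideal_retract[OF submodules(2,1) lin(4) fs(3) ss proj_emb_schur t(1)])
    then show "\<not> fg_ideal KS \<subseteq> M" using prod[OF t(1)[THEN carr] t(1)[THEN carr] t(2,2)] by blast
  next
    assume "\<not> fg_ideal KN \<subseteq> M \<and> \<not> fg_ideal KS \<subseteq> M"
    then obtain t u where t: "t \<in> fg_ideal KN" "t \<notin> M" and u: "u \<in> fg_ideal KS" "u \<notin> M"
      by blast
    have "t \<otimes> u \<otimes> (s \<otimes> s) \<in> fg_ideal KA"
      by (rule fg_ideal_combine[OF submodules(1,3,2) lin(1,3) fs(2,4) ss emb_proj_sum t(1) u(1)])
    then show "\<not> fg_ideal KA \<subseteq> M" using prod[OF t(1)[THEN carr] u(1)[THEN carr] t(2) u(2)] by blast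
  qed
qed

lemma transpose: "pivot R (\<lambda>i j. A j i) (\<lambda>i j. c j i) J I q p s"
proof unfold_locales
  show "s \<otimes> A j i = c j i \<otimes> A p q" if "i \<in> J" "j \<in> I" for i j
    using pivot[OF that(2,1)] .
qed (use fin_I fin_J p q c_pivot in auto)

text \<open>Exchanging rows and columns only swaps the factors of
  \<open>c i q \<otimes> c p j\<close>. This symmetry lets elimination run on a matrix and its
  transpose in step.\<close>

lemma schur_transpose: "pivot.schur R (\<lambda>i j. A j i) (\<lambda>i j. c j i) q p s = (\<lambda>i j. schur j i)"
proof (intro ext)
  fix i j
  interpret T: pivot R "\<lambda>i j. A j i" "\<lambda>i j. c j i" J I q p s by (rule transpose)
  show "T.schur i j = schur j i"
    by (simp add: T.schur_def schur_def m_comm)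
qed

end

section \<open>Transposing a matrix near a prime ideal\<close>

context cring
begin

text \<open>Divisibility up to denominators outside \<open>M\<close> is a total preorder, so a
  finite family has a member dividing all the others; primality keeps the product of the
  denominators outside \<open>M\<close>.\<close>

lemma exists_dominating_index:
  assumes M: "primeideal M R" and "finite K" "K \<noteq> {}" "\<And>k. a k \<in> carrier R"
    and cmp: "\<And>a b. \<lbrakk>a \<in> carrier R; b \<in> carrier R\<rbrakk> \<Longrightarrow>
      \<exists>s\<in>carrier R - M. \<exists>r\<in>carrier R. s \<otimes> a = r \<otimes> b \<or> s \<otimes> b = r \<otimes> a"
  shows "\<exists>m\<in>K. \<exists>s\<in>carrier R - M. \<forall>k\<in>K. \<exists>r\<in>carrier R. s \<otimes> a k = r \<otimes> a m"
  using assms(2,3)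
proof (induction rule: finite_ne_induct)
  case (singleton k)
  have "\<one> \<notin> M" by (rule primeideal_one_notin[OF M])
  then show ?case by auto
next
  case (insert l K)
  then obtain m s where m: "m \<in> K" "s \<in> carrier R" "s \<notin> M"
    "\<And>k. k \<in> K \<Longrightarrow> \<exists>r\<in>carrier R. s \<otimes> a k = r \<otimes> a m" by blast
  obtain t r where t: "t \<in> carrier R" "t \<notin> M" "r \<in> carrier R"
    "t \<otimes> a l = r \<otimes> a m \<or> t \<otimes> a m = r \<otimes> a l" using cmp[of "a l" "a m"] assms(4) by blast
  have ts: "t \<otimes> s \<in> carrier R - M"
    using m t primeideal.I_prime[OF M] by auto
  from t(4) show ?case
  proof
    assume eq: "t \<otimes> a l = r \<otimes> a m"
    have "\<exists>q\<in>carrier R. t \<otimes> s \<otimes> a k = q \<otimes> a m" if "k \<in> insert l K" for k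
    proof (cases "k = l")
      case True
      have "t \<otimes> s \<otimes> a l = s \<otimes> (t \<otimes> a l)" using assms(4) m(2) t(1) by (simp add: m_ac)
      also have "\<dots> = s \<otimes> r \<otimes> a m" using assms(4) m(2) t(3) by (simp add: eq m_assoc)
      finally show ?thesis using True m(2) t(3) by (intro bexI[of _ "s \<otimes> r"]) simp_all
    next
      case False
      then have "k \<in> K" using that by simp
      from m(4)[OF this] obtain q where q: "q \<in> carrier R" "s \<otimes> a k = q \<otimes> a m" by (rule bexE)
      have "t \<otimes> s \<otimes> a k = t \<otimes> q \<otimes> a m" using assms(4) m(2) t(1) q by (simp add: m_assoc)
      then show ?thesis using q(1) t(1) by (intro bexI[of _ "t \<otimes> q"]) simp_all
    qed
    then show ?thesis using m(1) ts by (intro bexI[of _ m] bexI[of _ "t \<otimes> s"]) auto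
  next
    \<comment> \<open>The new element locally divides the previous best one, hence everything that
      the latter divides.\<close>
    assume eq: "t \<otimes> a m = r \<otimes> a l"
    have "\<exists>q\<in>carrier R. t \<otimes> s \<otimes> a k = q \<otimes> a l" if "k \<in> insert l K" for k
    proof (cases "k = l")
      case True
      then show ?thesis using ts by (intro bexI[of _ "t \<otimes> s"]) simp_all
    next
      case False
      then have "k \<in> K" using that by simp
      from m(4)[OF this] obtain q where q: "q \<in> carrier R" "s \<otimes> a k = q \<otimes> a m" by (rule bexE)
      have "t \<otimes> s \<otimes> a k = t \<otimes> (q \<otimes> a m)" using assms(4) m(2) t(1) q by (simp add: m_assoc)
      also have "\<dots> = q \<otimes> (t \<otimes> a m)" using assms(4) t(1) q(1) by (simp add: m_lcomm)
      also have "\<dots> = q \<otimes> r \<otimes> a l" using assms(4) q(1) t(3) by (simp add: eq m_assoc)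
      finally show ?thesis using q(1) t(3) by (intro bexI[of _ "q \<otimes> r"]) simp_all
    qed
    then show ?thesis using ts by (intro bexI[of _ l] bexI[of _ "t \<otimes> s"]) auto
  qed
qed

lemma one_in_fg_idealI_span:
  assumes "fun_submodule K" "finite G" "G \<subseteq> K" "K \<subseteq> fun_span G"
  shows "\<one> \<in> fg_ideal K"
proof -
  have "vscale \<one> x = x" if "x \<in> K" for x using fun_submoduleD(1)[OF assms(1) that] by simp
  then show ?thesis using assms unfolding fg_ideal_def by auto
qed

lemma vecs_in_span:
  assumes "finite J" "x \<in> vecs J"
  shows "x \<in> fun_span ((\<lambda>j i. if i = j then \<one> else \<zero>) ` J)"
  using assms
proof (induction arbitrary: x rule: finite_induct)
  case empty
  then have "x = (\<lambda>i. \<zero>)" by (auto simp: vecs_def)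
  then show ?case using fun_span.zero by simp
next
  case (insert j J)
  let ?e = "\<lambda>j i. if i = j then \<one> else \<zero>"
  have "x(j := \<zero>) \<in> vecs J" using insert.prems by (auto simp: vecs_def)
  then have "x(j := \<zero>) \<in> fun_span (?e ` insert j J)"
    by (rule fun_span_mono[OF insert.IH]) auto
  then have "vadd (vscale (x j) (?e j)) (x(j := \<zero>)) \<in> fun_span (?e ` insert j J)"
    using fun_span.step[of "x j" "?e j" "?e ` insert j J" "x(j := \<zero>)"] vecs_closed[OF insert.prems]
    by simp
  moreover have "vadd (vscale (x j) (?e j)) (x(j := \<zero>)) = x"
    using vecs_closed[OF insert.prems] by auto
  ultimately show ?case by simp
qed

lemma fg_vecs:
  assumes "finite J"
  shows "\<one> \<in> fg_ideal (vecs J)"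
proof (rule one_in_fg_idealI_span[OF fun_submodule_vecs])
  show "vecs J \<subseteq> fun_span ((\<lambda>j i. if i = j then \<one> else \<zero>) ` J)"
    using vecs_in_span[OF assms] by blast
qed (use assms in \<open>auto simp: vecs_def\<close>)

text \<open>Induction on the number of rows: a pivot that locally divides all entries splits off the
  same annihilator on both sides and leaves Schur complements that are transposes of each other.
  Without rows or columns both kernels are full spaces \<open>vecs\<close>, which are finitely
  generated.\<close>

lemma fg_mat_ker_transpose:
  assumes M: "primeideal M R" and "finite I" "finite J" "\<And>i j. A i j \<in> carrier R"
    and cmp: "\<And>a b. \<lbrakk>a \<in> carrier R; b \<in> carrier R\<rbrakk> \<Longrightarrow>
      \<exists>s\<in>carrier R - M. \<exists>r\<in>carrier R. s \<otimes> a = r \<otimes> b \<or> s \<otimes> b = r \<otimes> a"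
  shows "\<not> fg_ideal (mat_ker A I J) \<subseteq> M \<longleftrightarrow> \<not> fg_ideal (mat_ker (\<lambda>i j. A j i) J I) \<subseteq> M"
  using assms(2-4)
proof (induction "card I" arbitrary: I J A)
  case (0 I J A)
  have one: "\<one> \<notin> M" by (rule primeideal_one_notin[OF M])
  have "I = {}" using 0 by simp
  moreover have "mat_ker A {} J = vecs J" "mat_ker (\<lambda>i j. A j i) J {} = vecs {}"
    by (auto simp: mat_ker_def)
  ultimately show ?case using fg_vecs[OF 0(3)] fg_vecs[of "{}"] one by auto
next
  case (Suc n I J A)
  have one: "\<one> \<notin> M" by (rule primeideal_one_notin[OF M])
  show ?case
  proof (cases "J = {}")
    case True
    have "mat_ker A I {} = vecs {}" "mat_ker (\<lambda>i j. A j i) {} I = vecs I"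
      by (auto simp: mat_ker_def)
    then show ?thesis using True fg_vecs[OF Suc.prems(1)] fg_vecs[of "{}"] one by auto
  next
    case False
    moreover have "I \<noteq> {}" using Suc.hyps by auto
    ultimately have "I \<times> J \<noteq> {}" by simp
    \<comment> \<open>The whole matrix is treated as one finite family: the pivot has to divide
      every entry, not only those of its row and column.\<close>
    then obtain m s where m: "m \<in> I \<times> J" and s: "s \<in> carrier R - M"
      and "\<forall>k\<in>I \<times> J. \<exists>r\<in>carrier R. s \<otimes> A (fst k) (snd k) = r \<otimes> A (fst m) (snd m)"
      using exists_dominating_index[OF M _ _ _ cmp, of "I \<times> J" "\<lambda>k. A (fst k) (snd k)"] Suc.prems
      by (metis finite_SigmaI)
    then obtain r where r: "\<And>k. k \<in> I \<times> J \<Longrightarrow> r k \<in> carrier R"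
      "\<And>k. k \<in> I \<times> J \<Longrightarrow> s \<otimes> A (fst k) (snd k) = r k \<otimes> A (fst m) (snd m)"
      by (metis (no_types))
    obtain p q where pq: "m = (p, q)" "p \<in> I" "q \<in> J" using m by auto
    \<comment> \<open>The quotient obtained at \<open>(p, q)\<close> may differ from
      \<open>s\<close> by an element annihilating the pivot, so it is replaced by \<open>s\<close>.
      The value zero outside the matrix keeps \<open>c\<close> in the carrier.\<close>
    define c where "c = (\<lambda>i j. if (i, j) = (p, q) then s else if i \<in> I \<and> j \<in> J then r (i, j) else \<zero>)"
    interpret P: pivot R A c I J p q s
    proof unfold_locales
      show "c i j \<in> carrier R" for i j using r(1) s by (auto simp: c_def)
      show "s \<otimes> A i j = c i j \<otimes> A p q" if "i \<in> I" "j \<in> J" for i j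
        using r(2)[of "(i, j)"] that pq by (auto simp: c_def)
    qed (use Suc.prems pq s in \<open>auto simp: c_def\<close>)
    interpret T: pivot R "\<lambda>i j. A j i" "\<lambda>i j. c j i" J I q p s by (rule P.transpose)
    have "n = card (I - {p})" using Suc.hyps(2) Suc.prems pq by simp
    then have "\<not> fg_ideal P.KS \<subseteq> M \<longleftrightarrow> \<not> fg_ideal T.KS \<subseteq> M"
      unfolding P.schur_transpose using Suc.prems by (intro Suc.hyps(1)) auto
    \<comment> \<open>The annihilator of the pivot occurs identically in both equivalences, so
      comparing the Schur complements is enough.\<close>
    then show ?thesis
      using P.fg_mat_ker_pivot[OF M] T.fg_mat_ker_pivot[OF M] s by auto
  qed
qed

end

section \<open>Extending linear maps by vanishing of Ext\<close>

lemma (in abelian_group) a_inv_zero [simp]: "\<ominus> \<zero> = \<zero>"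
  using minus_equality[of \<zero> \<zero>] by simp

lemma (in abelian_group) eq_of_minus_eq_zero:
  "\<lbrakk>a \<ominus> b = \<zero>; a \<in> carrier G; b \<in> carrier G\<rbrakk> \<Longrightarrow> a = b"
  using minus_equality[of a "\<ominus> b"] by (simp add: a_minus_def)

lemma (in abelian_group) minus_minus_swap:
  "\<lbrakk>a \<in> carrier G; b \<in> carrier G\<rbrakk> \<Longrightarrow> \<ominus> (a \<ominus> b) = b \<ominus> a"
  by (simp add: a_minus_def minus_add a_comm)

lemma (in abelian_group) minus_add_minus_cancel:
  "\<lbrakk>a \<in> carrier G; b \<in> carrier G; c \<in> carrier G\<rbrakk> \<Longrightarrow> (a \<ominus> b) \<oplus> (b \<ominus> c) = a \<ominus> c"
  by (simp add: a_minus_def a_assoc r_neg1)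

lemma linear_mapD:
  assumes "linear_map R M N f"
  shows "x \<in> carrier M \<Longrightarrow> f x \<in> carrier N"
    "\<lbrakk>x \<in> carrier M; y \<in> carrier M\<rbrakk> \<Longrightarrow> f (x \<oplus>\<^bsub>M\<^esub> y) = f x \<oplus>\<^bsub>N\<^esub> f y"
    "\<lbrakk>a \<in> carrier R; x \<in> carrier M\<rbrakk> \<Longrightarrow> f (a \<odot>\<^bsub>M\<^esub> x) = a \<odot>\<^bsub>N\<^esub> f x"
  using assms by (auto simp: linear_map_def)

lemma linear_map_zero:
  assumes "module R M" "module R N" "linear_map R M N f"
  shows "f \<zero>\<^bsub>M\<^esub> = \<zero>\<^bsub>N\<^esub>"
proof -
  interpret M: module R M by fact
  interpret N: module R N by fact
  have "f \<zero>\<^bsub>M\<^esub> = f (\<zero>\<^bsub>R\<^esub> \<odot>\<^bsub>M\<^esub> \<zero>\<^bsub>M\<^esub>)" by simp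
  also have "\<dots> = \<zero>\<^bsub>R\<^esub> \<odot>\<^bsub>N\<^esub> f \<zero>\<^bsub>M\<^esub>" using linear_mapD(3)[OF assms(3)] by blast
  finally show ?thesis using linear_mapD(1)[OF assms(3)] by simp
qed

lemma linear_map_minus:
  assumes "module R M" "module R N" "linear_map R M N f" "x \<in> carrier M"
  shows "f (\<ominus>\<^bsub>M\<^esub> x) = \<ominus>\<^bsub>N\<^esub> f x"
proof -
  interpret M: module R M by fact
  interpret N: module R N by fact
  have "f (\<ominus>\<^bsub>M\<^esub> x) \<oplus>\<^bsub>N\<^esub> f x = f (\<ominus>\<^bsub>M\<^esub> x \<oplus>\<^bsub>M\<^esub> x)"
    using assms(4) linear_mapD(2)[OF assms(3)] by simp
  then have "f (\<ominus>\<^bsub>M\<^esub> x) \<oplus>\<^bsub>N\<^esub> f x = \<zero>\<^bsub>N\<^esub>"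
    using assms(4) linear_map_zero[OF assms(1-3)] by (simp add: M.l_neg)
  then show ?thesis
    using assms(4) linear_mapD(1)[OF assms(3)] by (metis N.minus_equality M.a_inv_closed)
qed

lemma linear_map_image_submodule:
  assumes "module R M" "module R N" "linear_map R M N f"
  shows "submodule (f ` carrier M) R N"
proof -
  interpret M: module R M by fact
  interpret N: module R N by fact
  show ?thesis
  proof (rule N.submoduleI)
    show "\<zero>\<^bsub>N\<^esub> \<in> f ` carrier M"
      using linear_map_zero[OF assms] M.zero_closed by (metis imageI)
  next
    fix y assume "y \<in> f ` carrier M"
    then show "\<ominus>\<^bsub>N\<^esub> y \<in> f ` carrier M"
      using linear_map_minus[OF assms] by (metis (no_types, lifting) M.a_inv_closed imageE imageI)
  next
    fix y z assume "y \<in> f ` carrier M" "z \<in> f ` carrier M"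
    then show "y \<oplus>\<^bsub>N\<^esub> z \<in> f ` carrier M"
      using linear_mapD(2)[OF assms(3)] by (metis (no_types, lifting) M.a_closed imageE imageI)
  next
    fix a y assume "a \<in> carrier R" "y \<in> f ` carrier M"
    then show "a \<odot>\<^bsub>N\<^esub> y \<in> f ` carrier M"
      using linear_mapD(3)[OF assms(3)] by (metis (no_types, lifting) M.smult_closed imageE imageI)
  qed (use linear_mapD(1)[OF assms(3)] in auto)
qed

text \<open>The axioms pass along a surjection respecting the operations, where \<open>Q\<close> is
  at first a mere record. Thus \<open>rep_quotient\<close> becomes a module without a check of the
  axioms on representatives.\<close>

lemma module_linear_image:
  assumes "module R P" "linear_map R P Q f" "f ` carrier P = carrier Q" "f \<zero>\<^bsub>P\<^esub> = \<zero>\<^bsub>Q\<^esub>"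
  shows "module R Q"
proof -
  interpret P: module R P by fact
  note lin = linear_mapD(2,3)[OF assms(2), symmetric]
  have ex: "\<exists>u\<in>carrier P. x = f u" if "x \<in> carrier Q" for x
    using that assms(3) by blast
  have cl: "u \<in> carrier P \<Longrightarrow> f u \<in> carrier Q" for u
    using assms(3) by blast
  show ?thesis
  proof (intro moduleI abelian_groupI)
    show "cring R" by (rule P.R.is_cring)
    show "\<zero>\<^bsub>Q\<^esub> \<in> carrier Q" using cl assms(4) P.zero_closed by metis
  next
    fix x assume "x \<in> carrier Q"
    then obtain u where u: "u \<in> carrier P" "x = f u" using ex by blast
    show "\<zero>\<^bsub>Q\<^esub> \<oplus>\<^bsub>Q\<^esub> x = x" using u by (simp flip: assms(4) add: lin)
    have "f (\<ominus>\<^bsub>P\<^esub> u) \<oplus>\<^bsub>Q\<^esub> x = \<zero>\<^bsub>Q\<^esub>" using u by (simp flip: assms(4) add: lin P.l_neg)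
    then show "\<exists>y\<in>carrier Q. y \<oplus>\<^bsub>Q\<^esub> x = \<zero>\<^bsub>Q\<^esub>" using cl u by blast
    show "\<one>\<^bsub>R\<^esub> \<odot>\<^bsub>Q\<^esub> x = x" using u by (simp add: lin)
    fix a assume a: "a \<in> carrier R"
    show "a \<odot>\<^bsub>Q\<^esub> x \<in> carrier Q" using u a cl by (simp add: lin)
    fix b assume b: "b \<in> carrier R"
    show "(a \<oplus>\<^bsub>R\<^esub> b) \<odot>\<^bsub>Q\<^esub> x = a \<odot>\<^bsub>Q\<^esub> x \<oplus>\<^bsub>Q\<^esub> b \<odot>\<^bsub>Q\<^esub> x"
      using u a b by (simp add: lin P.smult_l_distr)
    show "(a \<otimes>\<^bsub>R\<^esub> b) \<odot>\<^bsub>Q\<^esub> x = a \<odot>\<^bsub>Q\<^esub> (b \<odot>\<^bsub>Q\<^esub> x)"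
      using u a b by (simp add: lin P.smult_assoc1)
  next
    fix x y assume "x \<in> carrier Q" "y \<in> carrier Q"
    then obtain u v where u: "u \<in> carrier P" "x = f u" and v: "v \<in> carrier P" "y = f v"
      using ex by blast
    show "x \<oplus>\<^bsub>Q\<^esub> y \<in> carrier Q" using u v cl by (simp add: lin)
    show "x \<oplus>\<^bsub>Q\<^esub> y = y \<oplus>\<^bsub>Q\<^esub> x" using u v by (simp add: lin P.a_comm)
    show "a \<odot>\<^bsub>Q\<^esub> (x \<oplus>\<^bsub>Q\<^esub> y) = a \<odot>\<^bsub>Q\<^esub> x \<oplus>\<^bsub>Q\<^esub> a \<odot>\<^bsub>Q\<^esub> y" if "a \<in> carrier R" for a
      using u v that by (simp add: lin P.smult_r_distr)
    fix z assume "z \<in> carrier Q"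
    then obtain w where "w \<in> carrier P" "z = f w" using ex by blast
    then show "x \<oplus>\<^bsub>Q\<^esub> y \<oplus>\<^bsub>Q\<^esub> z = x \<oplus>\<^bsub>Q\<^esub> (y \<oplus>\<^bsub>Q\<^esub> z)"
      using u v by (simp add: lin P.a_assoc)
  qed
qed

text \<open>Maps out of a quotient are checked on preimages; this is applied to the projection of
  the pushout.\<close>

lemma linear_map_factor:
  assumes "module R P" "linear_map R P Q f" "f ` carrier P = carrier Q" "linear_map R P F h"
    "\<And>u. u \<in> carrier P \<Longrightarrow> g (f u) = h u"
  shows "linear_map R Q F g"
  unfolding linear_map_def
proof (intro conjI ballI funcsetI)
  interpret P: module R P by fact
  note lin = linear_mapD(2,3)[OF assms(2), symmetric] linear_mapD(2,3)[OF assms(4)]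
  have ex: "\<exists>u\<in>carrier P. x = f u" if "x \<in> carrier Q" for x
    using that assms(3) by blast
  fix x assume "x \<in> carrier Q"
  then obtain u where u: "u \<in> carrier P" "x = f u" using ex by blast
  show "g x \<in> carrier F" using u assms(5) linear_mapD(1)[OF assms(4)] by simp
  show "g (a \<odot>\<^bsub>Q\<^esub> x) = a \<odot>\<^bsub>F\<^esub> g x" if "a \<in> carrier R" for a
    using u that by (simp add: assms(5) lin)
  fix y assume "y \<in> carrier Q"
  then obtain v where v: "v \<in> carrier P" "y = f v" using ex by blast
  show "g (x \<oplus>\<^bsub>Q\<^esub> y) = g x \<oplus>\<^bsub>F\<^esub> g y"
    using u v by (simp add: assms(5) lin)
qed

section \<open>Quotients, products and pushouts of modules\<close>

definition coset_rep :: "('a, 'p) module \<Rightarrow> 'p set \<Rightarrow> 'p \<Rightarrow> 'p" where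
  "coset_rep P N v = (SOME w. w \<in> carrier P \<and> v \<ominus>\<^bsub>P\<^esub> w \<in> N)"

text \<open>The quotient is carried by chosen coset representatives, so that it lives on the type of
  the original module, as the test modules of \<^const>\<open>fp_injective\<close> and \<^const>\<open>Ext1_vanishes\<close> must.\<close>

definition rep_quotient :: "('a, 'p) module \<Rightarrow> 'p set \<Rightarrow> ('a, 'p) module" where
  "rep_quotient P N =
     \<lparr> carrier = coset_rep P N ` carrier P,
       monoid.mult = (\<lambda>x y. x), one = \<zero>\<^bsub>P\<^esub>,
       ring.zero = coset_rep P N \<zero>\<^bsub>P\<^esub>,
       ring.add = (\<lambda>x y. coset_rep P N (x \<oplus>\<^bsub>P\<^esub> y)),
       module.smult = (\<lambda>a x. coset_rep P N (a \<odot>\<^bsub>P\<^esub> x)) \<rparr>"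

context
  fixes R :: "'a ring" and P :: "('a, 'p) module" and N
  assumes P: "module R P" and N: "submodule N R P"
begin

interpretation P: module R P by (rule P)

lemma coset_rep:
  assumes v: "v \<in> carrier P"
  shows "coset_rep P N v \<in> carrier P" "v \<ominus>\<^bsub>P\<^esub> coset_rep P N v \<in> N"
proof -
  have "v \<ominus>\<^bsub>P\<^esub> v \<in> N" using v P.submoduleE(2)[OF N] P.submoduleE(1)[OF N] submodule.axioms(1)[OF N]
    subgroup.one_closed[of N "add_monoid P"] by (simp add: P.minus_eq P.r_neg)
  then have "\<exists>w. w \<in> carrier P \<and> v \<ominus>\<^bsub>P\<^esub> w \<in> N" using v by blast
  from someI_ex[OF this]
  show "coset_rep P N v \<in> carrier P" "v \<ominus>\<^bsub>P\<^esub> coset_rep P N v \<in> N"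
    by (simp_all add: coset_rep_def)
qed

text \<open>Congruent \<open>v\<close> and \<open>w\<close> give extensionally equal predicates to
  the choice operator, so they receive the same representative.\<close>

lemma coset_rep_eq_iff:
  assumes v: "v \<in> carrier P" and w: "w \<in> carrier P"
  shows "coset_rep P N v = coset_rep P N w \<longleftrightarrow> v \<ominus>\<^bsub>P\<^esub> w \<in> N"
proof
  assume eq: "coset_rep P N v = coset_rep P N w"
  let ?r = "coset_rep P N w"
  have "(v \<ominus>\<^bsub>P\<^esub> ?r) \<oplus>\<^bsub>P\<^esub> \<ominus>\<^bsub>P\<^esub> (w \<ominus>\<^bsub>P\<^esub> ?r) \<in> N"
    using coset_rep[OF v] coset_rep[OF w] eq P.submoduleE[OF N] by simp
  moreover have "(v \<ominus>\<^bsub>P\<^esub> ?r) \<oplus>\<^bsub>P\<^esub> \<ominus>\<^bsub>P\<^esub> (w \<ominus>\<^bsub>P\<^esub> ?r) = v \<ominus>\<^bsub>P\<^esub> w"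
    using v w coset_rep(1)[OF w] by (simp add: P.minus_minus_swap P.minus_add_minus_cancel)
  ultimately show "v \<ominus>\<^bsub>P\<^esub> w \<in> N" by simp
next
  assume vw: "v \<ominus>\<^bsub>P\<^esub> w \<in> N"
  have "v \<ominus>\<^bsub>P\<^esub> u \<in> N \<longleftrightarrow> w \<ominus>\<^bsub>P\<^esub> u \<in> N" if u: "u \<in> carrier P" for u
  proof -
    have "v \<ominus>\<^bsub>P\<^esub> u = (v \<ominus>\<^bsub>P\<^esub> w) \<oplus>\<^bsub>P\<^esub> (w \<ominus>\<^bsub>P\<^esub> u)" "w \<ominus>\<^bsub>P\<^esub> u = \<ominus>\<^bsub>P\<^esub> (v \<ominus>\<^bsub>P\<^esub> w) \<oplus>\<^bsub>P\<^esub> (v \<ominus>\<^bsub>P\<^esub> u)"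
      using u v w by (simp_all add: P.minus_minus_swap P.minus_add_minus_cancel)
    then show ?thesis using vw P.submoduleE[OF N] by metis
  qed
  then show "coset_rep P N v = coset_rep P N w"
    unfolding coset_rep_def by (metis (no_types, lifting))
qed

lemma coset_rep_linear: "linear_map R P (rep_quotient P N) (coset_rep P N)"
  unfolding linear_map_def
proof (intro conjI ballI funcsetI)
  fix x assume x: "x \<in> carrier P"
  let ?x = "coset_rep P N x"
  note cx = coset_rep[OF x]
  show "?x \<in> carrier (rep_quotient P N)" using x by (simp add: rep_quotient_def)
  show "coset_rep P N (a \<odot>\<^bsub>P\<^esub> x) = a \<odot>\<^bsub>rep_quotient P N\<^esub> ?x" if a: "a \<in> carrier R" for a
  proof -
    have "a \<odot>\<^bsub>P\<^esub> x \<ominus>\<^bsub>P\<^esub> a \<odot>\<^bsub>P\<^esub> ?x = a \<odot>\<^bsub>P\<^esub> (x \<ominus>\<^bsub>P\<^esub> ?x)"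
      using a x cx(1) by (simp add: P.minus_eq P.smult_r_distr P.smult_r_minus)
    then have "coset_rep P N (a \<odot>\<^bsub>P\<^esub> x) = coset_rep P N (a \<odot>\<^bsub>P\<^esub> ?x)"
      using a x cx P.submoduleE[OF N] by (subst coset_rep_eq_iff) auto
    then show ?thesis by (simp add: rep_quotient_def)
  qed
  fix y assume y: "y \<in> carrier P"
  let ?y = "coset_rep P N y"
  note cy = coset_rep[OF y]
  have "(x \<oplus>\<^bsub>P\<^esub> y) \<ominus>\<^bsub>P\<^esub> (?x \<oplus>\<^bsub>P\<^esub> ?y) = (x \<ominus>\<^bsub>P\<^esub> ?x) \<oplus>\<^bsub>P\<^esub> (y \<ominus>\<^bsub>P\<^esub> ?y)"
    using x y cx(1) cy(1) by (simp add: P.minus_eq P.minus_add P.a_ac)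
  then have "coset_rep P N (x \<oplus>\<^bsub>P\<^esub> y) = coset_rep P N (?x \<oplus>\<^bsub>P\<^esub> ?y)"
    using x y cx cy P.submoduleE[OF N] by (subst coset_rep_eq_iff) auto
  then show "coset_rep P N (x \<oplus>\<^bsub>P\<^esub> y) = ?x \<oplus>\<^bsub>rep_quotient P N\<^esub> ?y"
    by (simp add: rep_quotient_def)
qed

lemma coset_rep_surj: "coset_rep P N ` carrier P = carrier (rep_quotient P N)"
  by (simp add: rep_quotient_def)

lemma module_rep_quotient: "module R (rep_quotient P N)"
  by (rule module_linear_image[OF P coset_rep_linear coset_rep_surj]) (simp add: rep_quotient_def)

lemma coset_rep_eq_zero_iff:
  assumes "v \<in> carrier P"
  shows "coset_rep P N v = \<zero>\<^bsub>rep_quotient P N\<^esub> \<longleftrightarrow> v \<in> N"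
  using coset_rep_eq_iff[OF assms P.zero_closed] assms by (simp add: rep_quotient_def P.minus_eq)

end

text \<open>\<open>E\<close> is the first factor because \<open>Ext1_vanishes\<close> expects
  extensions of \<open>F\<close> by \<open>E\<close> on the type
  \<open>'e \<times> 'f\<close>.\<close>

definition prod_module :: "('a, 'e) module \<Rightarrow> ('a, 'p) module \<Rightarrow> ('a, 'e \<times> 'p) module" where
  "prod_module E P =
     \<lparr> carrier = carrier E \<times> carrier P,
       monoid.mult = (\<lambda>x y. x), one = (\<zero>\<^bsub>E\<^esub>, \<zero>\<^bsub>P\<^esub>),
       ring.zero = (\<zero>\<^bsub>E\<^esub>, \<zero>\<^bsub>P\<^esub>),
       ring.add = (\<lambda>x y. (fst x \<oplus>\<^bsub>E\<^esub> fst y, snd x \<oplus>\<^bsub>P\<^esub> snd y)),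
       module.smult = (\<lambda>a x. (a \<odot>\<^bsub>E\<^esub> fst x, a \<odot>\<^bsub>P\<^esub> snd x)) \<rparr>"

lemma module_prod_module:
  assumes "module R E" "module R P"
  shows "module R (prod_module E P)"
proof -
  interpret E: module R E by fact
  interpret P: module R P by fact
  show ?thesis
  proof (intro moduleI abelian_groupI)
    fix x assume "x \<in> carrier (prod_module E P)"
    then show "\<exists>y\<in>carrier (prod_module E P). y \<oplus>\<^bsub>prod_module E P\<^esub> x = \<zero>\<^bsub>prod_module E P\<^esub>"
      by (intro bexI[of _ "(\<ominus>\<^bsub>E\<^esub> fst x, \<ominus>\<^bsub>P\<^esub> snd x)"]) (auto simp: prod_module_def E.l_neg P.l_neg)
  qed (auto simp: prod_module_def E.R.is_cring E.smult_l_distr E.smult_r_distr E.smult_assoc1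
      P.smult_l_distr P.smult_r_distr P.smult_assoc1 E.a_ac P.a_ac)
qed

text \<open>The extension tested is the pushout of \<open>P\<close> along \<open>\<phi>\<close>; a section of it yields the
  desired map.\<close>

lemma Ext1_vanishes_extend:
  fixes R :: "'a ring" and K :: "('a, 'k) module" and P :: "('a, 'p) module"
    and E :: "('a, 'e) module"
  assumes K: "module R K" and P: "module R P" and E: "module R E"
    and d: "linear_map R K P d" and \<phi>: "linear_map R K E \<phi>"
    and ker: "\<And>w. \<lbrakk>w \<in> carrier K; d w = \<zero>\<^bsub>P\<^esub>\<rbrakk> \<Longrightarrow> \<phi> w = \<zero>\<^bsub>E\<^esub>"
    and ext: "Ext1_vanishes R (rep_quotient P (d ` carrier K)) E"
  shows "\<exists>z. linear_map R P E z \<and> (\<forall>w\<in>carrier K. z (d w) = \<phi> w)"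
proof -
  interpret K: module R K by fact
  interpret P: module R P by fact
  interpret E: module R E by fact
  let ?EP = "prod_module E P"
  have EP: "module R ?EP" by (rule module_prod_module[OF E P])
  interpret EP: module R ?EP by (rule EP)
  have EPs: "carrier ?EP = carrier E \<times> carrier P" "\<zero>\<^bsub>?EP\<^esub> = (\<zero>\<^bsub>E\<^esub>, \<zero>\<^bsub>P\<^esub>)"
    "\<And>a b c d. (a, b) \<oplus>\<^bsub>?EP\<^esub> (c, d) = (a \<oplus>\<^bsub>E\<^esub> c, b \<oplus>\<^bsub>P\<^esub> d)"
    "\<And>r a b. r \<odot>\<^bsub>?EP\<^esub> (a, b) = (r \<odot>\<^bsub>E\<^esub> a, r \<odot>\<^bsub>P\<^esub> b)"
    by (auto simp: prod_module_def)
  have EPm: "(a, b) \<ominus>\<^bsub>?EP\<^esub> (c, d) = (a \<ominus>\<^bsub>E\<^esub> c, b \<ominus>\<^bsub>P\<^esub> d)"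
    if "a \<in> carrier E" "b \<in> carrier P" "c \<in> carrier E" "d \<in> carrier P" for a b c d
  proof -
    have "\<ominus>\<^bsub>?EP\<^esub> (c, d) = (\<ominus>\<^bsub>E\<^esub> c, \<ominus>\<^bsub>P\<^esub> d)"
      using that by (intro EP.minus_equality) (auto simp: EPs E.l_neg P.l_neg)
    then show ?thesis by (simp add: EP.minus_eq E.minus_eq P.minus_eq EPs)
  qed
  \<comment> \<open>The image of \<open>\<psi>\<close> is the relation module of the pushout: modulo
    it, \<open>(\<phi> w, 0)\<close> and \<open>(0, d w)\<close> agree.\<close>
  define \<psi> where "\<psi> w = (\<phi> w, \<ominus>\<^bsub>P\<^esub> d w)" for w
  have dc: "d w \<in> carrier P" and \<phi>c: "\<phi> w \<in> carrier E" if "w \<in> carrier K" for w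
    using linear_mapD(1)[OF d that] linear_mapD(1)[OF \<phi> that] by auto
  have \<psi>: "linear_map R K ?EP \<psi>"
    unfolding linear_map_def \<psi>_def
    using dc \<phi>c linear_mapD(2,3)[OF d] linear_mapD(2,3)[OF \<phi>]
    by (auto simp: EPs P.minus_add P.smult_r_minus)
  define N where "N = \<psi> ` carrier K"
  have N: "submodule N R ?EP" unfolding N_def by (rule linear_map_image_submodule[OF K EP \<psi>])
  define D where "D = d ` carrier K"
  have D: "submodule D R P" unfolding D_def by (rule linear_map_image_submodule[OF K P d])
  let ?F = "rep_quotient P D" and ?Y = "rep_quotient ?EP N"
  define \<rho> where "\<rho> = coset_rep P D"
  define \<pi> where "\<pi> = coset_rep ?EP N"
  have F: "module R ?F" and Y: "module R ?Y"
    using module_rep_quotient[OF P D] module_rep_quotient[OF EP N] .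
  interpret F: module R ?F by (rule F)
  interpret Y: module R ?Y by (rule Y)
  have \<rho>: "linear_map R P ?F \<rho>" and \<pi>: "linear_map R ?EP ?Y \<pi>"
    unfolding \<rho>_def \<pi>_def by (rule coset_rep_linear[OF P D] coset_rep_linear[OF EP N])+
  have \<rho>s: "\<rho> ` carrier P = carrier ?F" and \<pi>s: "\<pi> ` carrier ?EP = carrier ?Y"
    unfolding \<rho>_def \<pi>_def by (rule coset_rep_surj[OF P D] coset_rep_surj[OF EP N])+
  have shift: "\<pi> (\<zero>\<^bsub>E\<^esub>, d w) = \<pi> (\<phi> w, \<zero>\<^bsub>P\<^esub>)" if w: "w \<in> carrier K" for w
  proof -
    have "(\<zero>\<^bsub>E\<^esub>, d w) \<ominus>\<^bsub>?EP\<^esub> (\<phi> w, \<zero>\<^bsub>P\<^esub>) = \<psi> (\<ominus>\<^bsub>K\<^esub> w)"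
      using w dc \<phi>c linear_map_minus[OF K P d w] linear_map_minus[OF K E \<phi> w]
      by (simp add: EPm \<psi>_def E.minus_eq P.minus_eq)
    then show ?thesis
      unfolding \<pi>_def using w dc \<phi>c by (subst coset_rep_eq_iff[OF EP N]) (auto simp: EPs N_def)
  qed
  define i where "i r = \<pi> (r, \<zero>\<^bsub>P\<^esub>)" for r
  \<comment> \<open>Elements of \<open>?Y\<close> are themselves pairs, so \<open>p\<close> can read
    off the second component of the chosen representative; \<open>p\<pi>\<close> shows that the
    choice does not matter.\<close>
  define p where "p x = \<rho> (snd x)" for x :: "'e \<times> 'p"
  have i: "linear_map R E ?Y i"
    using linear_mapD[OF \<pi>] unfolding linear_map_def i_def by (auto simp: EPs simp flip: linear_mapD(2,3)[OF \<pi>])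
  \<comment> \<open>This is where \<open>ker\<close> enters: a relation with second component zero
    has \<open>d w\<close> zero, hence \<open>\<phi> w\<close> zero.\<close>
  have inj: "inj_on i (carrier E)"
  proof (rule inj_onI)
    fix r r' assume r: "r \<in> carrier E" "r' \<in> carrier E" and "i r = i r'"
    then have "(r, \<zero>\<^bsub>P\<^esub>) \<ominus>\<^bsub>?EP\<^esub> (r', \<zero>\<^bsub>P\<^esub>) \<in> N"
      unfolding i_def \<pi>_def using coset_rep_eq_iff[OF EP N] by (simp add: EPs)
    then obtain w where w: "w \<in> carrier K" "r \<ominus>\<^bsub>E\<^esub> r' = \<phi> w" "\<ominus>\<^bsub>P\<^esub> d w = \<zero>\<^bsub>P\<^esub>"
      using r by (auto simp: EPm N_def \<psi>_def P.minus_eq)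
    then have "d w = \<zero>\<^bsub>P\<^esub>" using dc[OF w(1)] P.M.minus_minus[of "d w"] by simp
    then have "r \<ominus>\<^bsub>E\<^esub> r' = \<zero>\<^bsub>E\<^esub>" using ker w by simp
    then show "r = r'" using r by (rule E.M.eq_of_minus_eq_zero)
  qed
  have p\<pi>: "p (\<pi> u) = \<rho> (snd u)" if u: "u \<in> carrier ?EP" for u
  proof -
    obtain r v where rv: "u = (r, v)" "r \<in> carrier E" "v \<in> carrier P" using u by (auto simp: EPs)
    obtain r' v' where rv': "\<pi> u = (r', v')" "r' \<in> carrier E" "v' \<in> carrier P"
      using coset_rep(1)[OF EP N u] unfolding \<pi>_def by (auto simp: EPs)
    have "u \<ominus>\<^bsub>?EP\<^esub> \<pi> u \<in> N" unfolding \<pi>_def by (rule coset_rep(2)[OF EP N u])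
    then obtain w where w: "w \<in> carrier K" "v \<ominus>\<^bsub>P\<^esub> v' = \<ominus>\<^bsub>P\<^esub> d w"
      using rv rv' by (auto simp: EPm N_def \<psi>_def)
    have "d w \<in> D" using w by (simp add: D_def)
    then have "v \<ominus>\<^bsub>P\<^esub> v' \<in> D" using w P.submoduleE[OF D] by simp
    then have "\<rho> v = \<rho> v'"
      unfolding \<rho>_def using rv rv' by (subst coset_rep_eq_iff[OF P D])
    then show ?thesis by (simp add: p_def rv' rv(1)[symmetric]) (simp add: rv)
  qed
  have snd_lin: "linear_map R ?EP ?F (\<lambda>u. \<rho> (snd u))"
    using linear_mapD[OF \<rho>] unfolding linear_map_def by (auto simp: EPs)
  have p: "linear_map R ?Y ?F p"
    by (rule linear_map_factor[OF EP \<pi> \<pi>s snd_lin p\<pi>])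
  have ps: "p ` carrier ?Y = carrier ?F"
  proof
    show "p ` carrier ?Y \<subseteq> carrier ?F" using linear_mapD(1)[OF p] by blast
    show "carrier ?F \<subseteq> p ` carrier ?Y"
    proof
      fix y assume "y \<in> carrier ?F"
      then obtain v where v: "v \<in> carrier P" "y = \<rho> v" using \<rho>s by blast
      then have "(\<zero>\<^bsub>E\<^esub>, v) \<in> carrier ?EP" by (simp add: EPs)
      then show "y \<in> p ` carrier ?Y" using v p\<pi> \<pi>s by (metis imageI snd_conv)
    qed
  qed
  have \<rho>z: "\<rho> v = \<zero>\<^bsub>?F\<^esub> \<longleftrightarrow> v \<in> D" if "v \<in> carrier P" for v
    unfolding \<rho>_def by (rule coset_rep_eq_zero_iff[OF P D that])
  have exact: "i ` carrier E = lin_kernel ?Y ?F p"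
  proof
    show "i ` carrier E \<subseteq> lin_kernel ?Y ?F p"
      using linear_mapD(1)[OF i] linear_map_zero[OF P F \<rho>]
      by (auto simp: lin_kernel_def) (simp add: i_def p\<pi> EPs)
    show "lin_kernel ?Y ?F p \<subseteq> i ` carrier E"
    proof
      fix x assume "x \<in> lin_kernel ?Y ?F p"
      then have "x \<in> carrier ?Y" and px: "p x = \<zero>\<^bsub>?F\<^esub>" by (auto simp: lin_kernel_def)
      then obtain r v where x: "x = \<pi> (r, v)" and r: "r \<in> carrier E" and v: "v \<in> carrier P"
        unfolding \<pi>s[symmetric] EPs by blast
      have "v \<in> D" using px p\<pi>[of "(r, v)"] r v \<rho>z unfolding x by (simp add: EPs)
      then obtain w where w: "w \<in> carrier K" "v = d w" by (auto simp: D_def)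
      have "x = \<pi> ((r, \<zero>\<^bsub>P\<^esub>) \<oplus>\<^bsub>?EP\<^esub> (\<zero>\<^bsub>E\<^esub>, d w))" using x w r v by (simp add: EPs)
      also have "\<dots> = \<pi> (r, \<zero>\<^bsub>P\<^esub>) \<oplus>\<^bsub>?Y\<^esub> \<pi> (\<zero>\<^bsub>E\<^esub>, d w)"
        using r w v by (intro linear_mapD(2)[OF \<pi>]) (auto simp: EPs)
      also have "\<dots> = i r \<oplus>\<^bsub>?Y\<^esub> i (\<phi> w)" using shift[OF w(1)] by (simp add: i_def)
      also have "\<dots> = i (r \<oplus>\<^bsub>E\<^esub> \<phi> w)" using linear_mapD(2)[OF i r \<phi>c[OF w(1)]] by simp
      finally show "x \<in> i ` carrier E" using r \<phi>c[OF w(1)] by blast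
    qed
  qed
  obtain \<sigma> where \<sigma>: "linear_map R ?F ?Y \<sigma>" "\<And>y. y \<in> carrier ?F \<Longrightarrow> p (\<sigma> y) = y"
    using ext Y i inj p ps exact unfolding Ext1_vanishes_def D_def[symmetric] by blast
  \<comment> \<open>Subtracting the section leaves the component in the kernel of \<open>p\<close>,
    which is the image of \<open>E\<close>; pulled back along \<open>i\<close> it is the required
    map.\<close>
  define h where "h v = \<pi> (\<zero>\<^bsub>E\<^esub>, v) \<ominus>\<^bsub>?Y\<^esub> \<sigma> (\<rho> v)" for v
  have hc: "\<pi> (\<zero>\<^bsub>E\<^esub>, v) \<in> carrier ?Y" "\<sigma> (\<rho> v) \<in> carrier ?Y" "\<rho> v \<in> carrier ?F" if "v \<in> carrier P" for v
    using that linear_mapD(1)[OF \<pi>] linear_mapD(1)[OF \<sigma>(1)] linear_mapD(1)[OF \<rho>] by (auto simp: EPs)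
  have h_ker: "h v \<in> i ` carrier E" if v: "v \<in> carrier P" for v
  proof -
    have "p (h v) = p (\<pi> (\<zero>\<^bsub>E\<^esub>, v)) \<oplus>\<^bsub>?F\<^esub> \<ominus>\<^bsub>?F\<^esub> p (\<sigma> (\<rho> v))"
      unfolding h_def Y.minus_eq using hc[OF v] linear_mapD(2)[OF p] linear_map_minus[OF Y F p] by simp
    also have "\<dots> = \<zero>\<^bsub>?F\<^esub>"
      using \<sigma>(2) hc(3)[OF v] p\<pi>[of "(\<zero>\<^bsub>E\<^esub>, v)"] v by (simp add: EPs F.r_neg)
    finally show ?thesis unfolding exact lin_kernel_def h_def using hc[OF v] by simp
  qed
  have h_add: "h (u \<oplus>\<^bsub>P\<^esub> v) = h u \<oplus>\<^bsub>?Y\<^esub> h v" if u: "u \<in> carrier P" and v: "v \<in> carrier P" for u v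
  proof -
    have 1: "\<pi> (\<zero>\<^bsub>E\<^esub>, u \<oplus>\<^bsub>P\<^esub> v) = \<pi> (\<zero>\<^bsub>E\<^esub>, u) \<oplus>\<^bsub>?Y\<^esub> \<pi> (\<zero>\<^bsub>E\<^esub>, v)"
      using linear_mapD(2)[OF \<pi>, of "(\<zero>\<^bsub>E\<^esub>, u)" "(\<zero>\<^bsub>E\<^esub>, v)"] u v by (simp add: EPs)
    have 2: "\<sigma> (\<rho> (u \<oplus>\<^bsub>P\<^esub> v)) = \<sigma> (\<rho> u) \<oplus>\<^bsub>?Y\<^esub> \<sigma> (\<rho> v)"
      using linear_mapD(2)[OF \<sigma>(1)] linear_mapD(2)[OF \<rho>] hc(3) u v by simp
    show ?thesis
      unfolding h_def 1 2 Y.minus_eq using hc[OF u] hc[OF v] by (simp add: Y.minus_add Y.a_ac)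
  qed
  have h_smult: "h (a \<odot>\<^bsub>P\<^esub> v) = a \<odot>\<^bsub>?Y\<^esub> h v" if a: "a \<in> carrier R" and v: "v \<in> carrier P" for a v
  proof -
    have 1: "\<pi> (\<zero>\<^bsub>E\<^esub>, a \<odot>\<^bsub>P\<^esub> v) = a \<odot>\<^bsub>?Y\<^esub> \<pi> (\<zero>\<^bsub>E\<^esub>, v)"
      using linear_mapD(3)[OF \<pi> a, of "(\<zero>\<^bsub>E\<^esub>, v)"] a v by (simp add: EPs)
    have 2: "\<sigma> (\<rho> (a \<odot>\<^bsub>P\<^esub> v)) = a \<odot>\<^bsub>?Y\<^esub> \<sigma> (\<rho> v)"
      using linear_mapD(3)[OF \<sigma>(1) a] linear_mapD(3)[OF \<rho> a] hc(3) v by simp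
    show ?thesis
      unfolding h_def 1 2 Y.minus_eq using a hc[OF v] by (simp add: Y.smult_r_distr Y.smult_r_minus)
  qed
  define z where "z v = inv_into (carrier E) i (h v)" for v
  have z: "z v \<in> carrier E" "i (z v) = h v" if "v \<in> carrier P" for v
    using h_ker[OF that] unfolding z_def by (auto intro: inv_into_into f_inv_into_f)
  have z_eq: "z v = r" if "v \<in> carrier P" "r \<in> carrier E" "h v = i r" for v r
    using inj_onD[OF inj, of "z v" r] z[OF that(1)] that by simp
  have "linear_map R P E z"
    unfolding linear_map_def
    using z h_add h_smult linear_mapD(2,3)[OF i] by (auto intro!: z_eq)
  moreover have "z (d w) = \<phi> w" if w: "w \<in> carrier K" for w
  proof (rule z_eq)
    \<comment> \<open>On the image of \<open>d\<close> the section contributes nothing, and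
      \<open>shift\<close> identifies what remains.\<close>
    have "\<rho> (d w) = \<zero>\<^bsub>?F\<^esub>" using \<rho>z[OF dc[OF w]] w by (simp add: D_def)
    then show "h (d w) = i (\<phi> w)"
      unfolding h_def Y.minus_eq using hc(1)[OF dc[OF w]] linear_map_zero[OF F Y \<sigma>(1)] shift[OF w]
      by (simp add: i_def)
  qed (use w dc \<phi>c in auto)
  ultimately show ?thesis by blast
qed

section \<open>Kernels of matrices over self fp-injective arithmetic rings\<close>

text \<open>\<open>free_module\<close>, \<open>self_module\<close> and resolutions are defined for
  \<open>'a ring\<close> records without extension, so the ring type is narrowed here.\<close>

locale plain_cring = cring R for R :: "'a ring" (structure)
begin

definition unit_vec :: "nat \<Rightarrow> nat \<Rightarrow> 'a" where
  "unit_vec j = (\<lambda>i. if i = j then \<one> else \<zero>)"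

lemma carrier_free_module: "carrier (free_module R k) = vecs {..<k}"
  by (auto simp: free_module_def vecs_def)

lemma free_module_simps:
  "\<zero>\<^bsub>free_module R k\<^esub> = (\<lambda>i. \<zero>)" "x \<oplus>\<^bsub>free_module R k\<^esub> y = vadd x y" "r \<odot>\<^bsub>free_module R k\<^esub> x = vscale r x"
  by (simp_all add: free_module_def)

lemma module_free_module: "module R (free_module R k)"
proof (intro moduleI abelian_groupI, unfold carrier_free_module free_module_simps)
  note sub = fun_submoduleD[OF fun_submodule_vecs]
  show "cring R" by (rule is_cring)
  show "(\<lambda>i. \<zero>) \<in> vecs {..<k}" by (rule sub(2))
  fix x assume x: "x \<in> vecs {..<k}"
  note xc = vecs_closed[OF x]
  show "vadd (\<lambda>i. \<zero>) x = x" "vscale \<one> x = x"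
    using xc by simp_all
  have "(\<lambda>i. \<ominus> x i) \<in> vecs {..<k}" using x by (auto simp: vecs_def)
  moreover have "vadd (\<lambda>i. \<ominus> x i) x = (\<lambda>i. \<zero>)" using xc by (simp add: l_neg)
  ultimately show "\<exists>y\<in>vecs {..<k}. vadd y x = (\<lambda>i. \<zero>)"
    by (intro bexI[of _ "\<lambda>i. \<ominus> x i"])
  show "vscale a x \<in> vecs {..<k}" if "a \<in> carrier R" for a
    using that x by (rule sub(4))
  show "vscale (a \<oplus> b) x = vadd (vscale a x) (vscale b x)" "vscale (a \<otimes> b) x = vscale a (vscale b x)"
    if "a \<in> carrier R" "b \<in> carrier R" for a b
    using that xc by (simp_all add: l_distr m_assoc)
  fix y assume y: "y \<in> vecs {..<k}"
  note yc = vecs_closed[OF y]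
  show "vadd x y \<in> vecs {..<k}" using x y by (rule sub(3))
  show "vadd x y = vadd y x" using xc yc by (simp add: a_comm)
  show "vscale a (vadd x y) = vadd (vscale a x) (vscale a y)" if "a \<in> carrier R" for a
    using that xc yc by (simp add: r_distr)
  show "vadd (vadd x y) z = vadd x (vadd y z)" if "z \<in> vecs {..<k}" for z
    using vecs_closed[OF that] xc yc by (simp add: a_assoc)
qed

lemma module_self_module: "module R (self_module R)"
proof (intro moduleI abelian_groupI, simp_all add: self_module_def is_cring l_distr r_distr m_assoc a_assoc)
  show "x \<oplus> y = y \<oplus> x" if "x \<in> carrier R" "y \<in> carrier R" for x y
    using that by (rule a_comm)
qed

lemma unit_vec_in_vecs: "j \<in> J \<Longrightarrow> unit_vec j \<in> vecs J"
  by (auto simp: unit_vec_def vecs_def)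

text \<open>The induction runs over the support \<open>J\<close> inside a fixed free module, so a
  coordinate can be split off without changing the rank.\<close>

lemma linear_functional_expand:
  assumes g: "linear_map R (free_module R k) (self_module R) g"
    and "finite J" "J \<subseteq> {..<k}" "x \<in> vecs J"
  shows "g x = (\<Oplus>j\<in>J. g (unit_vec j) \<otimes> x j)"
  using assms(2-4)
proof (induction arbitrary: x rule: finite_induct)
  case empty
  then have "x = \<zero>\<^bsub>free_module R k\<^esub>" by (auto simp: vecs_def free_module_simps)
  then show ?case
    using linear_map_zero[OF module_free_module module_self_module g] by (simp add: self_module_def)
next
  case (insert j J)
  note car = vecs_closed[OF insert.prems(2)]
  let ?u = "vscale (x j) (unit_vec j)" and ?y = "x(j := \<zero>)"
  have y: "?y \<in> vecs J" "?y \<in> vecs {..<k}"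
    using insert.prems by (auto simp: vecs_def)
  have e: "unit_vec i \<in> carrier (free_module R k)" if "i \<in> insert j J" for i
    using that insert.prems(1) by (auto simp: carrier_free_module intro!: unit_vec_in_vecs)
  then have u: "?u \<in> carrier (free_module R k)"
    using fun_submoduleD(4)[OF fun_submodule_vecs car, of "unit_vec j" "{..<k}" j]
    by (simp add: carrier_free_module)
  have gc: "g (unit_vec i) \<in> carrier R" if "i \<in> insert j J" for i
    using linear_mapD(1)[OF g e[OF that]] by (simp add: self_module_def)
  have "x = ?u \<oplus>\<^bsub>free_module R k\<^esub> ?y"
    using car by (auto simp: free_module_simps unit_vec_def)
  then have "g x = g ?u \<oplus> g ?y"
    using linear_mapD(2)[OF g u, of ?y] y by (simp add: carrier_free_module self_module_def)
  also have "g ?u = x j \<otimes> g (unit_vec j)"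
    using linear_mapD(3)[OF g car[of j] e] by (simp add: free_module_simps self_module_def)
  also have "\<dots> = g (unit_vec j) \<otimes> x j" using car gc by (simp add: m_comm)
  also have "g ?y = (\<Oplus>i\<in>J. g (unit_vec i) \<otimes> ?y i)"
    using insert.IH insert.prems(1) y(1) by simp
  also have "\<dots> = (\<Oplus>i\<in>J. g (unit_vec i) \<otimes> x i)"
    using insert.hyps(2) car gc by (intro finsum_cong') auto
  finally show ?case using insert.hyps car gc by (simp add: Pi_def)
qed

lemma component_functional:
  assumes "linear_map R M (free_module R l) d"
  shows "linear_map R M (self_module R) (\<lambda>x. d x i)"
  using linear_mapD[OF assms] vecs_closed[of _ "{..<l}"] unfolding linear_map_def
  by (simp add: free_module_simps self_module_def carrier_free_module)

lemma dot_functional: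
  assumes "\<And>j. a j \<in> carrier R"
  shows "linear_map R (free_module R k) (self_module R) (\<lambda>v. \<Oplus>j\<in>{..<k}. a j \<otimes> v j)"
  unfolding linear_map_def carrier_free_module free_module_simps
proof (intro conjI ballI funcsetI)
  fix v assume v: "v \<in> vecs {..<k}"
  note vc = vecs_closed[OF v]
  show "(\<Oplus>j\<in>{..<k}. a j \<otimes> v j) \<in> carrier (self_module R)"
    using assms vc by (simp add: self_module_def)
  show "(\<Oplus>j\<in>{..<k}. a j \<otimes> (r \<otimes> v j)) = r \<odot>\<^bsub>self_module R\<^esub> (\<Oplus>j\<in>{..<k}. a j \<otimes> v j)"
    if r: "r \<in> carrier R" for r
    using assms vc r by (simp add: self_module_def finsum_rdistr m_lcomm)
  show "(\<Oplus>j\<in>{..<k}. a j \<otimes> (v j \<oplus> w j)) =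
      (\<Oplus>j\<in>{..<k}. a j \<otimes> v j) \<oplus>\<^bsub>self_module R\<^esub> (\<Oplus>j\<in>{..<k}. a j \<otimes> w j)"
    if w: "w \<in> vecs {..<k}" for w
    using assms vc vecs_closed[OF w] by (simp add: self_module_def r_distr finsum_addf)
qed

lemma finsum_in_fun_span:
  assumes "finite J" "\<And>j. c j \<in> carrier R" "\<And>j i. g j i \<in> carrier R"
  shows "(\<lambda>i. \<Oplus>j\<in>J. c j \<otimes> g j i) \<in> fun_span (g ` J)"
  using assms(1)
proof (induction rule: finite_induct)
  case empty
  then show ?case using fun_span.zero by simp
next
  case (insert j J)
  have "(\<lambda>i. \<Oplus>j\<in>J. c j \<otimes> g j i) \<in> fun_span (g ` insert j J)"
    using fun_span_mono[OF insert.IH] by auto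
  from fun_span.step[OF assms(2) _ this, of "g j" j]
  have "vadd (vscale (c j) (g j)) (\<lambda>i. \<Oplus>j\<in>J. c j \<otimes> g j i) \<in> fun_span (g ` insert j J)"
    by simp
  then show ?case using insert.hyps assms by (simp add: Pi_def)
qed

lemma fg_imp_free_surjection:
  assumes K: "fun_submodule K" "K \<subseteq> vecs {..<k}" and fg: "\<one> \<in> fg_ideal K"
  shows "\<exists>m f. linear_map R (free_module R m) (free_module R k) f \<and> f ` carrier (free_module R m) = K"
proof -
  obtain G where G: "finite G" "G \<subseteq> K" and one: "\<forall>x\<in>K. vscale \<one> x \<in> fun_span G"
    using fg by (auto simp: fg_ideal_def)
  have span: "x \<in> fun_span G" if "x \<in> K" for x
  proof -
    have "vscale \<one> x = x" using fun_submoduleD(1)[OF K(1) that] by simp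
    then show ?thesis using one that by metis
  qed
  obtain m and g0 :: "nat \<Rightarrow> nat \<Rightarrow> 'a" where g0: "G = g0 ` {i. i < m}"
    using finite_imp_nat_seg_image_inj_on[OF G(1)] by blast
  \<comment> \<open>Padding with zero places every \<open>g j\<close> in \<open>K\<close>, so
    closure facts need no bound on \<open>j\<close>.\<close>
  define g where "g j = (if j < m then g0 j else (\<lambda>i. \<zero>))" for j
  have g: "G = g ` {..<m}" "\<And>j. g j \<in> K"
    using g0 G(2) fun_submoduleD(2)[OF K(1)] by (auto simp: g_def)
  note gc = fun_submoduleD(1)[OF K(1) g(2)]
  define f where "f x = (\<lambda>i. \<Oplus>j\<in>{..<m}. x j \<otimes> g j i)" for x
  have fK: "f x \<in> K" if x: "x \<in> vecs {..<m}" for x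
  proof -
    have "f x \<in> fun_span (g ` {..<m})"
      unfolding f_def using finsum_in_fun_span[of "{..<m}" x g] vecs_closed[OF x] gc by blast
    then show ?thesis using fun_span_subset[OF K(1) G(2)] g(1) by simp
  qed
  have lin: "linear_map R (free_module R m) (free_module R k) f"
    unfolding linear_map_def carrier_free_module free_module_simps
  proof (intro conjI ballI funcsetI)
    fix x assume x: "x \<in> vecs {..<m}"
    show "f x \<in> vecs {..<k}" using fK[OF x] K(2) by blast
    show "f (vscale r x) = vscale r (f x)" if "r \<in> carrier R" for r
      using that vecs_closed[OF x] gc by (simp add: f_def finsum_rdistr m_assoc)
    show "f (vadd x y) = vadd (f x) (f y)" if y: "y \<in> vecs {..<m}" for y
      using vecs_closed[OF x] vecs_closed[OF y] gc by (simp add: f_def l_distr finsum_addf)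
  qed
  \<comment> \<open>Surjectivity by induction on the span: adding \<open>r\<close> times a generator
    amounts to adding \<open>r\<close> times a unit vector to the preimage.\<close>
  have "v \<in> f ` vecs {..<m}" if "v \<in> fun_span G" for v
    using that
  proof induction
    case zero
    have "f (\<lambda>i. \<zero>) = (\<lambda>i. \<zero>)"
      using linear_map_zero[OF module_free_module module_free_module lin] by (simp add: free_module_simps)
    then show ?case by (intro rev_image_eqI[OF fun_submoduleD(2)[OF fun_submodule_vecs]]) simp
  next
    case (step r h v)
    obtain j where j: "j < m" "h = g j" using step(2) g(1) by auto
    obtain x where x: "x \<in> vecs {..<m}" "v = f x" using step(4) by blast
    let ?u = "vscale r (unit_vec j)"
    have ej: "unit_vec j \<in> vecs {..<m}" using j by (simp add: unit_vec_in_vecs)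
    have u: "?u \<in> vecs {..<m}" using fun_submoduleD(4)[OF fun_submodule_vecs step(1) ej] .
    have "f (unit_vec j) = g j"
    proof
      fix i
      have "(\<Oplus>l\<in>{..<m}. unit_vec j l \<otimes> g l i) = (\<Oplus>l\<in>{..<m}. if j = l then g l i else \<zero>)"
        using gc by (intro finsum_cong') (auto simp: unit_vec_def)
      also have "\<dots> = g j i" using finsum_singleton[of j "{..<m}" "\<lambda>l. g l i"] j gc by auto
      finally show "f (unit_vec j) i = g j i" by (simp add: f_def)
    qed
    then have "f ?u = vscale r h"
      using linear_mapD(3)[OF lin step(1)] ej j by (simp add: carrier_free_module free_module_simps)
    then have fu: "f (vadd ?u x) = vadd (vscale r h) v"
      using linear_mapD(2)[OF lin] u x by (simp add: carrier_free_module free_module_simps)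
    have "vadd ?u x \<in> vecs {..<m}" using fun_submoduleD(3)[OF fun_submodule_vecs u x(1)] .
    then show ?case by (rule rev_image_eqI) (simp only: fu)
  qed
  then have "f ` vecs {..<m} = K" using span fK by (intro equalityI subsetI) auto
  then show ?thesis using lin by (intro exI[of _ m] exI[of _ f]) (simp add: carrier_free_module)
qed

lemma linear_map_eq_matrix:
  assumes "linear_map R (free_module R k) (free_module R l) d" "x \<in> vecs {..<k}"
  shows "d x i = (\<Oplus>j\<in>{..<k}. d (unit_vec j) i \<otimes> x j)"
  using linear_functional_expand[OF component_functional[OF assms(1)] finite_lessThan order_refl assms(2)] .

text \<open>The cokernel of \<open>d\<close> is presented by \<open>d\<close> itself, hence is a
  legitimate test module. A functional vanishing on the kernel of \<open>d\<close> induces one on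
  the image of \<open>d\<close>, and vanishing of Ext for the cokernel extends that to the whole
  target.\<close>

lemma self_fp_injective_extend:
  assumes "self_fp_injective R" and d: "linear_map R (free_module R k) (free_module R l) d"
    and \<phi>: "linear_map R (free_module R k) (self_module R) \<phi>"
    and ker: "\<And>w. \<lbrakk>w \<in> vecs {..<k}; d w = (\<lambda>i. \<zero>)\<rbrakk> \<Longrightarrow> \<phi> w = \<zero>"
  shows "\<exists>z. linear_map R (free_module R l) (self_module R) z \<and> (\<forall>w\<in>vecs {..<k}. z (d w) = \<phi> w)"
proof -
  let ?P = "free_module R l"
  define D where "D = d ` carrier (free_module R k)"
  have D: "submodule D R ?P"
    unfolding D_def by (rule linear_map_image_submodule[OF module_free_module module_free_module d])
  let ?F = "rep_quotient ?P D"
  have "lin_kernel ?P ?F (coset_rep ?P D) = D"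
    using coset_rep_eq_zero_iff[OF module_free_module D] submodule.axioms(1)[OF D]
      module.submoduleE(1)[OF module_free_module D]
    by (auto simp: lin_kernel_def)
  then have "has_partial_resolution R ?F 1"
    unfolding has_partial_resolution_def
    using coset_rep_linear[OF module_free_module D] coset_rep_surj[OF module_free_module D] d
    by (intro exI[of _ "\<lambda>i. if i = 0 then l else k"] exI[of _ "coset_rep ?P D"] exI[of _ "\<lambda>_. d"])
      (auto simp: D_def)
  then have "Ext1_vanishes R ?F (self_module R)"
    using assms(1) module_rep_quotient[OF module_free_module D]
    unfolding self_fp_injective_def fp_injective_def finitely_presented_def by blast
  then have "\<exists>z. linear_map R ?P (self_module R) z \<and> (\<forall>w\<in>carrier (free_module R k). z (d w) = \<phi> w)"
    unfolding D_def using ker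
    by (intro Ext1_vanishes_extend[OF module_free_module module_free_module module_self_module d \<phi>])
      (auto simp: carrier_free_module free_module_simps self_module_def)
  then show ?thesis by (simp add: carrier_free_module)
qed

section \<open>Prolonging a resolution by one step\<close>

lemma next_syzygy_fg:
  assumes arith: "arithmetic_ring R" and inj: "self_fp_injective R"
    and d1: "linear_map R (free_module R k1) (free_module R k0) d1"
    and d2: "linear_map R (free_module R k2) (free_module R k1) d2"
    and exact: "d2 ` carrier (free_module R k2) = lin_kernel (free_module R k1) (free_module R k0) d1"
  shows "\<exists>m f. linear_map R (free_module R m) (free_module R k2) f \<and>
    f ` carrier (free_module R m) = lin_kernel (free_module R k2) (free_module R k1) d2"
proof -
  \<comment> \<open>Columns are images of unit vectors; the value zero beyond the rank puts the
    entries in the carrier for arbitrary indices.\<close>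
  define A where "A i j = (if j < k1 then d1 (unit_vec j) i else \<zero>)" for i j
  define B where "B i j = (if j < k2 then d2 (unit_vec j) i else \<zero>)" for i j
  have ev: "j < k \<Longrightarrow> unit_vec j \<in> vecs {..<k}" for j k by (simp add: unit_vec_in_vecs)
  have d1v: "d1 v \<in> vecs {..<k0}" if "v \<in> vecs {..<k1}" for v
    using linear_mapD(1)[OF d1] that by (simp add: carrier_free_module)
  have d2v: "d2 v \<in> vecs {..<k1}" if "v \<in> vecs {..<k2}" for v
    using linear_mapD(1)[OF d2] that by (simp add: carrier_free_module)
  have Ac: "A i j \<in> carrier R" and Bc: "B i j \<in> carrier R" for i j
    using vecs_closed[OF d1v[OF ev]] vecs_closed[OF d2v[OF ev]] by (auto simp: A_def B_def)
  have d1A: "d1 x i = (\<Oplus>j\<in>{..<k1}. A i j \<otimes> x j)" if x: "x \<in> vecs {..<k1}" for x i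
    unfolding linear_map_eq_matrix[OF d1 x]
    using vecs_closed[OF d1v[OF ev]] vecs_closed[OF x] by (intro finsum_cong') (auto simp: A_def)
  have d2B: "d2 x i = (\<Oplus>j\<in>{..<k2}. B i j \<otimes> x j)" if x: "x \<in> vecs {..<k2}" for x i
    unfolding linear_map_eq_matrix[OF d2 x]
    using vecs_closed[OF d2v[OF ev]] vecs_closed[OF x] by (intro finsum_cong') (auto simp: B_def)
  let ?Bt = "\<lambda>i j. B j i"
  let ?K = "mat_ker B {..<k1} {..<k2}" and ?Kt = "mat_ker ?Bt {..<k2} {..<k1}"
  have K: "fun_submodule ?K" and Kt: "fun_submodule ?Kt"
    using Bc by (auto intro!: fun_submodule_mat_ker)
  have ker: "lin_kernel (free_module R k2) (free_module R k1) d2 = ?K"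
  proof -
    have "d2 x = (\<lambda>i. \<zero>) \<longleftrightarrow> (\<forall>i<k1. d2 x i = \<zero>)" if "x \<in> vecs {..<k2}" for x
      using d2v[OF that] by (auto simp: vecs_def)
    then show ?thesis
      by (auto simp: lin_kernel_def mat_ker_def carrier_free_module free_module_simps d2B)
  qed
  have d1d2: "d1 (d2 y) = (\<lambda>i. \<zero>)" if "y \<in> vecs {..<k2}" for y
    using exact that by (auto simp: lin_kernel_def carrier_free_module free_module_simps)
  \<comment> \<open>Evaluating \<open>d1 (d2 y) = 0\<close> on unit vectors \<open>y\<close> says
    that the transpose of \<open>B\<close> kills each row of \<open>A\<close>.\<close>
  have rows: "A i \<in> ?Kt" for i
  proof -
    have "(\<Oplus>j\<in>{..<k1}. B j l \<otimes> A i j) = \<zero>" if l: "l < k2" for l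
    proof -
      have "(\<Oplus>j\<in>{..<k1}. B j l \<otimes> A i j) = (\<Oplus>j\<in>{..<k1}. A i j \<otimes> d2 (unit_vec l) j)"
        using Ac Bc vecs_closed[OF d2v[OF ev[OF l]]] l by (intro finsum_cong') (auto simp: B_def m_comm)
      also have "\<dots> = d1 (d2 (unit_vec l)) i" using d1A[OF d2v[OF ev[OF l]]] by simp
      finally show ?thesis using d1d2[OF ev[OF l]] by simp
    qed
    moreover have "A i \<in> vecs {..<k1}" using Ac by (auto simp: vecs_def) (simp add: A_def)
    ultimately show ?thesis by (auto simp: mat_ker_def)
  qed
  have "x \<in> fun_span (A ` {..<k0})" if x: "x \<in> ?Kt" for x
  proof -
    have xv: "x \<in> vecs {..<k1}" using x by (simp add: mat_ker_def)
    note xc = vecs_closed[OF xv]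
    define \<phi> where "\<phi> v = (\<Oplus>j\<in>{..<k1}. x j \<otimes> v j)" for v
    have \<phi>: "linear_map R (free_module R k1) (self_module R) \<phi>"
      unfolding \<phi>_def using xc by (rule dot_functional)
    \<comment> \<open>A vector in the kernel of \<open>d1\<close> is some \<open>d2 y\<close>, and
      the coefficients of \<open>\<phi>\<close> composed with \<open>d2\<close> are the entries of
      the transpose of \<open>B\<close> applied to \<open>x\<close>, which vanish.\<close>
    have "\<phi> w = \<zero>" if "w \<in> vecs {..<k1}" "d1 w = (\<lambda>i. \<zero>)" for w
    proof -
      have "w \<in> d2 ` vecs {..<k2}"
        using that exact by (auto simp: lin_kernel_def carrier_free_module free_module_simps)
      then obtain y where y: "y \<in> vecs {..<k2}" "w = d2 y" by blast
      have lin: "linear_map R (free_module R k2) (self_module R) (\<lambda>y. \<phi> (d2 y))"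
        using linear_mapD[OF d2] linear_mapD[OF \<phi>] unfolding linear_map_def by auto
      have "\<phi> (d2 (unit_vec l)) = \<zero>" if l: "l < k2" for l
      proof -
        have "\<phi> (d2 (unit_vec l)) = (\<Oplus>j\<in>{..<k1}. B j l \<otimes> x j)"
          unfolding \<phi>_def using xc Bc vecs_closed[OF d2v[OF ev[OF l]]] l
          by (intro finsum_cong') (auto simp: B_def m_comm)
        then show ?thesis using x l by (simp add: mat_ker_def)
      qed
      then have "(\<Oplus>l\<in>{..<k2}. \<phi> (d2 (unit_vec l)) \<otimes> y l) = (\<Oplus>l\<in>{..<k2}. \<zero>)"
        using vecs_closed[OF y(1)] by (intro finsum_cong') auto
      then show ?thesis
        using linear_functional_expand[OF lin finite_lessThan order_refl y(1)] y(2) by simp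
    qed
    then obtain z where z: "linear_map R (free_module R k0) (self_module R) z"
      "\<And>w. w \<in> vecs {..<k1} \<Longrightarrow> z (d1 w) = \<phi> w"
      using self_fp_injective_extend[OF inj d1 \<phi>] by blast
    \<comment> \<open>The values of the extension \<open>z\<close> on unit vectors are the
      coefficients that express \<open>x\<close> through the rows of \<open>A\<close>.\<close>
    define c where "c i = (if i < k0 then z (unit_vec i) else \<zero>)" for i
    have cc: "c i \<in> carrier R" for i
      using linear_mapD(1)[OF z(1)] ev[of i k0]
      by (auto simp: c_def carrier_free_module self_module_def)
    have "x j = (\<Oplus>i\<in>{..<k0}. c i \<otimes> A i j)" for j
    proof (cases "j < k1")
      case True
      have "(\<Oplus>l\<in>{..<k1}. x l \<otimes> unit_vec j l) = (\<Oplus>l\<in>{..<k1}. if j = l then x l else \<zero>)"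
        using xc by (intro finsum_cong') (auto simp: unit_vec_def)
      also have "\<dots> = x j" using finsum_singleton[of j "{..<k1}" x] True xc by auto
      finally have "x j = z (d1 (unit_vec j))" using z(2)[OF ev[OF True]] by (simp add: \<phi>_def)
      also have "\<dots> = (\<Oplus>i\<in>{..<k0}. z (unit_vec i) \<otimes> d1 (unit_vec j) i)"
        by (rule linear_functional_expand[OF z(1) finite_lessThan order_refl d1v[OF ev[OF True]]])
      also have "\<dots> = (\<Oplus>i\<in>{..<k0}. c i \<otimes> A i j)"
        using True cc[unfolded c_def] vecs_closed[OF d1v[OF ev[OF True]]]
        by (intro finsum_cong') (auto simp: c_def A_def intro!: m_closed cc Ac split: if_splits)
      finally show ?thesis .
    next
      case False
      have "(\<Oplus>i\<in>{..<k0}. c i \<otimes> A i j) = (\<Oplus>i\<in>{..<k0}. \<zero>)"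
        using cc False by (intro finsum_cong') (auto simp: A_def)
      then show ?thesis using xv False by (simp add: vecs_def)
    qed
    then have "x = (\<lambda>j. \<Oplus>i\<in>{..<k0}. c i \<otimes> A i j)" by (rule ext)
    then show ?thesis using finsum_in_fun_span[of "{..<k0}" c A] cc Ac by simp
  qed
  then have fgt: "\<one> \<in> fg_ideal ?Kt"
    using rows by (intro one_in_fg_idealI_span[OF Kt, of "A ` {..<k0}"]) auto
  have "\<one> \<in> fg_ideal ?K"
  proof (rule one_in_fg_idealI_local[OF K])
    fix M assume M: "maximalideal M R"
    have prime: "primeideal M R" by (rule maximalideal_prime[OF M])
    have "\<not> fg_ideal ?Kt \<subseteq> M" using fgt primeideal_one_notin[OF prime] by blast
    then show "\<not> fg_ideal ?K \<subseteq> M"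
      using fg_mat_ker_transpose[OF prime _ _ Bc arithmetic_comparable[OF arith M], of "{..<k1}" "{..<k2}"]
      by simp
  qed
  then show ?thesis
    unfolding ker by (intro fg_imp_free_surjection[OF K]) (auto simp: mat_ker_def)
qed

text \<open>For \<open>n \<ge> 2\<close> both \<open>d (n - 1)\<close> and \<open>d n\<close> are
  maps between free modules, which is what \<open>next_syzygy_fg\<close> asks for.\<close>

lemma has_partial_resolution_Suc:
  assumes arith: "arithmetic_ring R" and inj: "self_fp_injective R"
    and n: "n \<ge> 2" and res: "has_partial_resolution R E n"
  shows "has_partial_resolution R E (Suc n)"
proof -
  obtain k d0 d where
    d0: "linear_map R (free_module R (k 0)) E d0" "d0 ` carrier (free_module R (k 0)) = carrier E"
    and d': "\<forall>i\<in>{1..n}. linear_map R (free_module R (k i)) (free_module R (k (i - 1))) (d i)"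
    and ex1': "1 \<le> n \<longrightarrow> d 1 ` carrier (free_module R (k 1)) = lin_kernel (free_module R (k 0)) E d0"
    and ex': "\<forall>i\<in>{1..<n}. d (i + 1) ` carrier (free_module R (k (i + 1))) =
      lin_kernel (free_module R (k i)) (free_module R (k (i - 1))) (d i)"
    using res unfolding has_partial_resolution_def by (elim exE conjE)
  note d = bspec[OF d'] and ex = bspec[OF ex']
  obtain l where l: "n = Suc (Suc l)" using n by (metis add_2_eq_Suc le_Suc_ex)
  have "\<exists>m f. linear_map R (free_module R m) (free_module R (k n)) f \<and>
    f ` carrier (free_module R m) = lin_kernel (free_module R (k n)) (free_module R (k (n - 1))) (d n)"
    using d[of "n - 1"] d[of n] ex[of "n - 1"] l
    by (intro next_syzygy_fg[OF arith inj, of "k (n - 1)" "k (n - 2)" "d (n - 1)"]) simp_all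
  then obtain m f where f: "linear_map R (free_module R m) (free_module R (k n)) f"
    "f ` carrier (free_module R m) = lin_kernel (free_module R (k n)) (free_module R (k (n - 1))) (d n)"
    by blast
  let ?k = "k(Suc n := m)" and ?d = "d(Suc n := f)"
  have 1: "linear_map R (free_module R (?k i)) (free_module R (?k (i - 1))) (?d i)" if "i \<in> {1..Suc n}" for i
    using that d[of i] f(1) by (cases "i = Suc n") auto
  have 2: "?d (i + 1) ` carrier (free_module R (?k (i + 1))) =
      lin_kernel (free_module R (?k i)) (free_module R (?k (i - 1))) (?d i)" if "i \<in> {1..<Suc n}" for i
    using that ex[of i] f(2) by (cases "i = n") auto
  have 3: "?d 1 ` carrier (free_module R (?k 1)) = lin_kernel (free_module R (?k 0)) E d0"
    using ex1' n by simp
  have 0: "?k 0 = k 0" by simp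
  show ?thesis
    unfolding has_partial_resolution_def
    by (rule exI[of _ ?k], rule exI[of _ d0], rule exI[of _ ?d]) (use d0 1 2 3 in \<open>simp only: 0 simp_thms ball_simps, blast\<close>)
qed

end

text \<open>\<open>\<lambda>\<close>-dim at most 2 means exactly that this implication holds for
  every module, hence \<open>E\<close> ranges over an arbitrary type.\<close>

theorem theorem2p4:
  fixes R :: "'a ring" and E :: "('a, 'm) module"
  assumes "cring R"
    and "arithmetic_ring R"
    and "self_fp_injective R"
    and "module R E"
    and "lambda_inv R E \<ge> 2"
  shows "lambda_inv R E = \<infinity>"
proof -
  interpret plain_cring R by (rule plain_cring.intro) fact
  \<comment> \<open>The supremum is taken over integers: without a resolution of length 2 or more it
    would be at most 1.\<close>
  have "\<exists>n\<ge>2. has_partial_resolution R E n"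
  proof (rule ccontr)
    assume "\<not> ?thesis"
    then have "n \<le> 1" if "has_partial_resolution R E n" for n
      using that by (metis not_less_eq_eq numeral_2_eq_2 One_nat_def)
    then have "lambda_inv R E \<le> 1"
      unfolding lambda_inv_def by (intro Sup_least) (auto simp: one_ereal_def)
    with assms(5) have "(2::ereal) \<le> 1" by (rule order_trans)
    then show False by simp
  qed
  then obtain n where n: "n \<ge> 2" "has_partial_resolution R E n" by blast
  have res: "has_partial_resolution R E (n + m)" for m
  proof (induction m)
    case 0
    then show ?case using n by simp
  next
    case (Suc m)
    then show ?case using has_partial_resolution_Suc[OF assms(2,3) _ Suc] n(1) by simp
  qed
  show ?thesis
  proof (rule ereal_top)
    \<comment> \<open>Resolutions of every length \<open>n + m\<close> push the supremum above any
      real.\<close>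
    fix b :: real
    obtain m where "b \<le> real m" using real_arch_simple by blast
    then have "ereal b \<le> ereal (real (n + m))" by simp
    also have "\<dots> \<le> lambda_inv R E"
      unfolding lambda_inv_def using res by (intro Sup_upper) blast
    finally show "ereal b \<le> lambda_inv R E" .
  qed
qed

end
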